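(* Let $A\in\mathbb{C}^{m\times n}$ with $m\ge n$, let $1\le k_1<\min(k_m,k_n)$ with $k_m\le m$, $k_n\le n$, and let $[\widehat U_1\ \widehat U_2\ \widehat U_3]$ and $[\widehat V_1\ \widehat V_2\ \widehat V_3]$ be square unitary matrices, with $\widehat U_1,\widehat U_2,\widehat U_3$ having $k_1$, $k_m-k_1$, $m-k_m$ columns and $\widehat V_1,\widehat V_2,\widehat V_3$ having $k_1$, $k_n-k_1$, $n-k_n$ columns, such that $$[\widehat U_1\ \widehat U_2\ \widehat U_3]^*A[\widehat V_1\ \widehat V_2\ \widehat V_3]=\begin{bmatrix}\widehat\Sigma_1&0&R_1\\0&\widehat\Sigma_2&R_2\\S_1&S_2&A_3\end{bmatrix},$$ where $\widehat\Sigma_1\in\mathbb{R}^{k_1\times k_1}$, $\widehat\Sigma_2\in\mathbb{R}^{(k_m-k_1)\times(k_n-k_1)}$, and $\mathrm{diag}(\widehat\Sigma_1,\widehat\Sigma_2)$ equals $\begin{bmatrix}\mathrm{diag}(\widehat\sigma_1,\ldots,\widehat\sigma_k)\\0\end{bmatrix}$ if $k_m\ge k_n=k$ and $[\mathrm{diag}(\widehat\sigma_1,\ldots,\widehat\sigma_k)\ \ 0_{k\times(k_n-k)}]$ if $k=k_m<k_n$. Let $(\Sigma_1,U_1,V_1)$ be the $k_1$ leading singular triplets of $A$ (so $\Sigma_1=\mathrm{diag}(\sigma_1(A),\ldots,\sigma_{k_1}(A))$, $AV_1=U_1\Sigma_1$, $U_1^*A=\Sigma_1V_1^*$, $U_1,V_1$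 with orthonormal columns). Define $\mathrm{Gap}=\min(\sigma(\widehat\Sigma_1)-\sigma(A_3))$ and $\mathrm{gap}=\sigma_{\min}(\Sigma_1)-\|\widehat\Sigma_2\|$, and suppose $\mathrm{Gap}>0$ and $\mathrm{gap}>0$. Write $S=[S_1\ S_2]$, $R=\begin{bmatrix}R_1\\R_2\end{bmatrix}$, and for a unitarily invariant norm $|||\cdot|||$ let $|||\Theta|||=\max(|||\sin\angle(U_1,\widehat U_1)|||,\ |||\sin\angle(V_1,\widehat V_1)|||)$. Then for every unitarily invariant norm: (i) $$|||\Theta|||\le\frac{\max(|||R|||,|||S|||)}{\mathrm{Gap}}\Big(1+\frac{\max(\|R_2\|,\|S_2\|)}{\mathrm{gap}}\Big);$$ (ii) if $\mathrm{Gap}>\max(\|S_2\|,\|R_2\|)^2/\mathrm{gap}$, then $$|||\Theta|||\le\frac{\max(|||S_1|||,|||R_1|||)}{\mathrm{Gap}-\frac{\max(\|S_2\|,\|R_2\|)^2}{\mathrm{gap}}}\Big(1+\frac{\max(\|R_2\|,\|S_2\|)}{\mathrm{gap}}\Big);$$ (iii) let $k'=\max(k_m-k_1,k_n-k_1)$, let $r_{2i}^T$ be the $i$-th row of $R_2$ and $s_{2i}$ the $i$-th column of $S_2$, with the conventions $r_{2i}=0$ for $i>k_m-k_1$, $s_{2i}=0$ for $i>k_n-k_1$, and $\widehat\sigma_{k_1+i}=0$ for $i>\min(k_m,k_n)-k_1$. If $\mathrm{Gap}>\sum_{i=1}^{k'}\frac{\max(\|r_{2i}\|,\|s_{2i}\|)^2}{\sigma_{\min}(\Sigma_1)-\widehat\sigma_{k_1+i}}$,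 then $$|||\Theta|||\le\frac{\max(|||S_1|||,|||R_1|||)}{\mathrm{Gap}-\sum_{i=1}^{k'}\frac{\max(\|r_{2i}\|,\|s_{2i}\|)^2}{\sigma_{\min}(\Sigma_1)-\widehat\sigma_{k_1+i}}}\Big(1+\sum_{i=1}^{k'}\frac{\max(\|r_{2i}\|,\|s_{2i}\|)}{\sigma_{\min}(\Sigma_1)-\widehat\sigma_{k_1+i}}\Big).$$
   Context: $\|\cdot\|$ without subscript is the spectral norm (Euclidean norm for vectors). $\sigma(M)$ is the set of singular values of $M$, $\sigma_{\min}$ the smallest one, and $\min(\sigma(\widehat\Sigma_1)-\sigma(A_3))$ means the minimum of $a-b$ over $a\in\sigma(\widehat\Sigma_1)$, $b\in\sigma(A_3)$, i.e. $\sigma_{\min}(\widehat\Sigma_1)-\|A_3\|$. For matrices $X,\widehat X$ with $p$ orthonormal columns each, the canonical angles are $\theta_i=\arccos\sigma_i(X^*\widehat X)$, and $\sin\angle(X,\widehat X)=\mathrm{diag}(\sin\theta_1,\ldots,\sin\theta_p)$. Blocks $R$ or $S$ may be empty.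
   Formalization: The diagonal entries σ̂_i are assumed nonnegative, as approximate singular values; claim (iii) can fail if a trailing σ̂_{k_1+i} is negative, while (i) and (ii) for negative entries follow by changing signs of columns of Û. *)

theory Defs
  imports "Jordan_Normal_Form.Schur_Decomposition" "Jordan_Normal_Form.Char_Poly"
    "HOL-Computational_Algebra.Polynomial"
begin

definition append_cols :: "'a :: zero mat \<Rightarrow> 'a mat \<Rightarrow> 'a mat" where
  "append_cols A B = four_block_mat A B (0\<^sub>m 0 (dim_col A)) (0\<^sub>m 0 (dim_col B))"

definition unitary_mat :: "nat \<Rightarrow> complex mat \<Rightarrow> bool" where
  "unitary_mat n U \<longleftrightarrow> U \<in> carrier_mat n n \<and> mat_adjoint U * U = 1\<^sub>m n"

definition orthonormal_cols :: "complex mat \<Rightarrow> bool" where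
  "orthonormal_cols X \<longleftrightarrow> mat_adjoint X * X = 1\<^sub>m (dim_col X)"

definition sing_vals :: "complex mat \<Rightarrow> real list" where
  "sing_vals M = take (min (dim_row M) (dim_col M))
     (rev (sorted_list_of_multiset
        (image_mset (\<lambda>z. sqrt (Re z)) (proots (char_poly (mat_adjoint M * M))))))"

definition sing_val :: "complex mat \<Rightarrow> nat \<Rightarrow> real" where
  "sing_val M i = sing_vals M ! (i - 1)"

definition sigma_min :: "complex mat \<Rightarrow> real" where
  "sigma_min M = Min (set (sing_vals M))"

text \<open>Spectral norm (largest singular value; 0 for empty matrices).\<close>
definition spec_norm :: "complex mat \<Rightarrow> real" where
  "spec_norm M = Max (insert 0 (set (sing_vals M)))"

definition vec_norm2 :: "complex vec \<Rightarrow> real" where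
  "vec_norm2 v = sqrt (\<Sum>i<dim_vec v. (cmod (v $ i))\<^sup>2)"

definition rdiag :: "nat \<Rightarrow> (nat \<Rightarrow> real) \<Rightarrow> complex mat" where
  "rdiag k d = mat k k (\<lambda>(i,j). if i = j then complex_of_real (d (Suc i)) else 0)"

definition rect_diag :: "nat \<Rightarrow> nat \<Rightarrow> (nat \<Rightarrow> real) \<Rightarrow> complex mat" where
  "rect_diag p q f = mat p q (\<lambda>(i,j). if i = j then complex_of_real (f (Suc i)) else 0)"

text \<open>sin of the canonical angles between the column spaces of X and Xh
  (both with p orthonormal columns): diag(sin theta_1, ..., sin theta_p),
  theta_i = arccos sigma_i(X^* Xh).\<close>
definition sin_angle :: "complex mat \<Rightarrow> complex mat \<Rightarrow> complex mat" where
  "sin_angle X Xh = rdiag (dim_col X)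
     (\<lambda>i. sin (arccos (sing_val (mat_adjoint X * Xh) i)))"

text \<open>A unitarily invariant norm, defined on matrices of all sizes: a norm on each
  C^{m x n}, invariant under multiplication by unitary matrices on both sides, and
  compatible across sizes (unchanged by padding with zero rows/columns), i.e. it is
  given by one symmetric gauge function of the singular values.\<close>
definition ui_norm :: "(complex mat \<Rightarrow> real) \<Rightarrow> bool" where
  "ui_norm N \<longleftrightarrow>
     (\<forall>m n A. A \<in> carrier_mat m n \<longrightarrow> 0 \<le> N A \<and> (N A = 0 \<longleftrightarrow> A = 0\<^sub>m m n)) \<and>
     (\<forall>m n A B. A \<in> carrier_mat m n \<longrightarrow> B \<in> carrier_mat m n \<longrightarrow> N (A + B) \<le> N A + N B) \<and>
     (\<forall>A c. N (c \<cdot>\<^sub>m A) = cmod c * N A) \<and>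
     (\<forall>m n A U V. A \<in> carrier_mat m n \<longrightarrow> unitary_mat m U \<longrightarrow> unitary_mat n V \<longrightarrow>
        N (U * A * V) = N A) \<and>
     (\<forall>m n A. A \<in> carrier_mat m n \<longrightarrow>
        N (A @\<^sub>r 0\<^sub>m 1 n) = N A \<and> N (append_cols A (0\<^sub>m m 1)) = N A)"

end

theory Submission
  imports Defs
begin

text \<open>
  Write \<open>X = \<^bold>U\<^sup>* U\<^sub>1\<close> and \<open>Y = \<^bold>V\<^sup>* V\<^sub>1\<close> in blocks \<open>X\<^sub>i\<close>, \<open>Y\<^sub>i\<close>, where \<open>\<^bold>U\<close>, \<open>\<^bold>V\<close> are the given unitary
  matrices. The second and third block rows of \<open>\<^bold>U\<^sup>* A \<^bold>V Y = X \<Sigma>\<^sub>1\<close> and of its adjoint counterpart couple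
  these blocks. The second ones bound \<open>max |||X\<^sub>2||| |||Y\<^sub>2|||\<close> by a multiple of \<open>max |||X\<^sub>3||| |||Y\<^sub>3|||\<close>, either as
  a whole or row by row for (iii); inserted into the third ones this bounds \<open>max |||X\<^sub>3||| |||Y\<^sub>3|||\<close>. The gap is
  measured with \<open>\<sigma>\<^sub>m\<^sub>i\<^sub>n \<Sigma>\<^sub>1\<close>, which by the Courant-Fischer principle dominates the smallest singular
  value of the leading block (a compression of \<open>A\<close>), and \<open>|||sin\<angle>(U\<^sub>1, \<^bold>U\<^sub>1)||| \<le> |||X\<^sub>2||| + |||X\<^sub>3|||\<close> because \<open>X\<close> is an isometry.
  The inequality \<open>|||C B||| \<le> \<parallel>C\<parallel> |||B|||\<close> follows from the Hermitian dilation of \<open>C\<close>, which is \<open>\<parallel>C\<parallel>\<close> times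
  the average of two unitary matrices.
\<close>

section \<open>Adjoints and Euclidean norms\<close>

text \<open>The obstacle is that the second block rows bound \<open>X2\<close> through
  \<open>Y2\<close> and \<open>Y2\<close> through \<open>X2\<close>, so neither can be estimated
  alone. Both inequalities carry the same spectral norm of \<open>Sig2\<close>, hence they close for
  the larger of the two norms. This is why maxima over the \<open>U\<close> and \<open>V\<close>
  sides pervade the bounds and where the factor \<open>1 / gap\<close> arises. Inserting the result
  into the third block rows costs a second coupling factor, whence the square over
  \<open>gap\<close> subtracted from \<open>Gap\<close>. In (i) that loss is avoided by keeping
  \<open>S\<close> and \<open>R\<close> whole, since \<open>Y1\<close> stacked on \<open>Y2\<close>
  is a contraction. In (iii) the diagonal shape of \<open>Sig2\<close> lets row \<open>i\<close> of
  \<open>X2\<close> interact only with row \<open>i\<close> of \<open>Y2\<close>, so that each row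
  has its own gap.

  An abstract unitarily invariant norm offers the triangle inequality, unitary invariance and zero
  padding, but no formula in singular values. Every inequality about it is therefore reduced to sums
  of unitary multiples of padded matrices. A dilation is square and Hermitian whatever the shape of
  \<open>C\<close>, which puts it within reach of the spectral theorem.\<close>

abbreviation (input) adj :: "complex mat \<Rightarrow> complex mat" where "adj \<equiv> mat_adjoint"

lemma adj_eq: "adj A = mat (dim_col A) (dim_row A) (\<lambda>(i,j). cnj (A $$ (j,i)))"
  unfolding mat_adjoint_def mat_of_rows_def
  by (rule eq_matI) (auto simp: conjugate_complex_def)

lemma adj_dim [simp]: "dim_row (adj A) = dim_col A" "dim_col (adj A) = dim_row A"
  by (auto simp: adj_eq)

lemma adj_carrier [simp]: "adj A \<in> carrier_mat n m \<longleftrightarrow> A \<in> carrier_mat m n"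
  by (metis adj_dim carrier_matD carrier_matI)

lemma adj_index [simp]: "i < dim_col A \<Longrightarrow> j < dim_row A \<Longrightarrow> adj A $$ (i,j) = cnj (A $$ (j,i))"
  by (simp add: adj_eq)

lemma adj_adj [simp]: "adj (adj A) = A"
  by (rule eq_matI) auto

lemma adj_one [simp]: "adj (1\<^sub>m n) = 1\<^sub>m n"
  by (rule eq_matI) auto

lemma adj_zero [simp]: "adj (0\<^sub>m n m) = 0\<^sub>m m n"
  by (rule eq_matI) auto

text \<open>The side conditions are dimension equations instead of carrier sets: these the
  simplifier can discharge while it reassociates long products.\<close>

lemma mat_assoc:
  "dim_col A = dim_row B \<Longrightarrow> dim_col B = dim_row C \<Longrightarrow> A * B * C = A * (B * (C :: 'a :: semiring_0 mat))"
  by (rule assoc_mult_mat) auto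

lemma mat_distrib:
  "dim_row A = dim_row B \<Longrightarrow> dim_col A = dim_col B \<Longrightarrow> dim_col B = dim_row C \<Longrightarrow>
    (A + B) * C = A * C + B * (C :: 'a :: semiring_0 mat)"
  "dim_row B = dim_row C \<Longrightarrow> dim_col B = dim_col C \<Longrightarrow> dim_col A = dim_row C \<Longrightarrow>
    A * (B + C) = A * B + A * (C :: 'a :: semiring_0 mat)"
  by (rule add_mult_distrib_mat mult_add_distrib_mat; auto)+

lemma mat_one [simp]:
  "dim_row A = n \<Longrightarrow> 1\<^sub>m n * A = (A :: 'a :: semiring_1 mat)"
  "dim_col A = n \<Longrightarrow> A * 1\<^sub>m n = (A :: 'a :: semiring_1 mat)"
  by (auto intro!: eq_matI)

lemma mat_zero [simp]:
  "dim_row A = n \<Longrightarrow> dim_col A = m \<Longrightarrow> 0\<^sub>m n m + A = (A :: 'a :: monoid_add mat)"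
  "dim_row A = n \<Longrightarrow> dim_col A = m \<Longrightarrow> A + 0\<^sub>m n m = (A :: 'a :: monoid_add mat)"
  "dim_row B = m \<Longrightarrow> 0\<^sub>m n m * B = (0\<^sub>m n (dim_col B) :: 'b :: semiring_0 mat)"
  "dim_col B = n \<Longrightarrow> B * 0\<^sub>m n m = (0\<^sub>m (dim_row B) m :: 'b :: semiring_0 mat)"
  by (auto intro!: eq_matI)

lemma adj_mult: "dim_col A = dim_row B \<Longrightarrow> adj (A * B) = adj B * adj A"
  by (rule eq_matI) (auto simp: scalar_prod_def intro!: sum.cong)

lemma adj_four_block:
  assumes "A \<in> carrier_mat p q" "B \<in> carrier_mat p q'" "C \<in> carrier_mat p' q" "D \<in> carrier_mat p' q'"
  shows "adj (four_block_mat A B C D) = four_block_mat (adj A) (adj C) (adj B) (adj D)"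
  using assms by (intro eq_matI) (auto simp: not_less)

lemma adj_diag: "adj (mat_diag n f) = mat_diag n (\<lambda>i. cnj (f i))"
  by (rule eq_matI) (auto simp: mat_diag_def)

lemma mat_diag_sizes [simp]: "dim_row (mat_diag n f) = n" "dim_col (mat_diag n f) = n"
  by (auto simp: mat_diag_def)

lemma mat_diag_cong: "(\<And>i. i < n \<Longrightarrow> f i = g i) \<Longrightarrow> mat_diag n f = mat_diag n g"
  by (auto simp: mat_diag_def intro!: eq_matI)

lemma unitary_matD:
  assumes "unitary_mat n U"
  shows "U \<in> carrier_mat n n" "dim_row U = n" "dim_col U = n" "adj U * U = 1\<^sub>m n" "U * adj U = 1\<^sub>m n"
proof -
  show U: "U \<in> carrier_mat n n" "adj U * U = 1\<^sub>m n" using assms by (auto simp: unitary_mat_def)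
  then show "dim_row U = n" "dim_col U = n" by auto
  show "U * adj U = 1\<^sub>m n" using mat_mult_left_right_inverse[of "adj U" n U] U by simp
qed

lemma unitary_one: "unitary_mat n (1\<^sub>m n)"
  by (simp add: unitary_mat_def)

lemma unitary_adj:
  assumes "unitary_mat n U"
  shows "unitary_mat n (adj U)"
  using unitary_matD[OF assms] by (simp add: unitary_mat_def)

text \<open>Companion of \<open>mat_assoc\<close>: once a product is nested to the right, an inverse
  pair is cancelled in front of the remaining tail.\<close>

lemma mult_cancel_left_inverse:
  "A * B = 1\<^sub>m n \<Longrightarrow> dim_col A = dim_row B \<Longrightarrow> dim_col B = dim_row C \<Longrightarrow> dim_row C = n \<Longrightarrow>
    A * (B * C) = (C :: 'a :: semiring_1 mat)"
  by (subst mat_assoc[symmetric]) auto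

lemma unitary_mult:
  assumes "unitary_mat n U" "unitary_mat n V"
  shows "unitary_mat n (U * V)"
  using unitary_matD[OF assms(1)] unitary_matD[OF assms(2)]
  by (simp add: unitary_mat_def adj_mult mat_assoc mult_cancel_left_inverse[of "adj U" U n])

section \<open>Euclidean length of complex vectors and of their images under a matrix\<close>

lemma vec_norm2_nonneg [simp]: "0 \<le> vec_norm2 v"
  by (simp add: vec_norm2_def sum_nonneg)

lemma vec_norm2_sq: "(vec_norm2 v)\<^sup>2 = (\<Sum>i<dim_vec v. (cmod (v $ i))\<^sup>2)"
  by (simp add: vec_norm2_def sum_nonneg)

lemma vec_norm2_eq_0: "vec_norm2 v = 0 \<longleftrightarrow> v = 0\<^sub>v (dim_vec v)"
proof -
  have "vec_norm2 v = 0 \<longleftrightarrow> (vec_norm2 v)\<^sup>2 = 0" by simp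
  also have "\<dots> \<longleftrightarrow> v = 0\<^sub>v (dim_vec v)"
    unfolding vec_norm2_sq by (subst sum_nonneg_eq_0_iff) (auto intro!: eq_vecI simp: vec_eq_iff)
  finally show ?thesis .
qed

lemma vec_norm2_cscalar: "complex_of_real ((vec_norm2 v)\<^sup>2) = v \<bullet>c v"
  unfolding vec_norm2_sq scalar_prod_def
  by (auto simp: conjugate_complex_def complex_norm_square[symmetric] atLeast0LessThan simp del: of_real_power
      intro!: sum.cong)

lemma cscalar_adj:
  assumes "x \<in> carrier_vec (dim_col A)" "y \<in> carrier_vec (dim_row A)"
  shows "(A *\<^sub>v x) \<bullet>c y = x \<bullet>c (adj A *\<^sub>v y)"
proof -
  have "(A *\<^sub>v x) \<bullet>c y = (\<Sum>i<dim_row A. \<Sum>j<dim_col A. A $$ (i,j) * x $ j * cnj (y $ i))"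
    using assms by (auto simp: scalar_prod_def conjugate_complex_def atLeast0LessThan sum_distrib_right)
  also have "\<dots> = (\<Sum>j<dim_col A. \<Sum>i<dim_row A. A $$ (i,j) * x $ j * cnj (y $ i))"
    by (rule sum.swap)
  also have "\<dots> = x \<bullet>c (adj A *\<^sub>v y)"
    using assms by (auto simp: scalar_prod_def conjugate_complex_def atLeast0LessThan sum_distrib_left
        cnj_sum algebra_simps intro!: sum.cong)
  finally show ?thesis .
qed

lemma vec_norm2_gram:
  assumes "x \<in> carrier_vec (dim_col A)"
  shows "complex_of_real ((vec_norm2 (A *\<^sub>v x))\<^sup>2) = x \<bullet>c ((adj A * A) *\<^sub>v x)"
proof -
  have "(adj A * A) *\<^sub>v x = adj A *\<^sub>v (A *\<^sub>v x)"
    by (rule assoc_mult_mat_vec[of _ "dim_col A" "dim_row A" _ "dim_col A"]) (use assms in auto)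
  moreover have "A *\<^sub>v x \<in> carrier_vec (dim_row A)"
    by (rule carrier_vecI) simp
  ultimately show ?thesis
    unfolding vec_norm2_cscalar by (simp only: cscalar_adj[OF assms])
qed

text \<open>The squared length of \<open>A x\<close> is the form \<open>x^* (A^* A) x\<close>, which
  sees \<open>A\<close> only through its Gram matrix. A matrix may thus be traded for a simpler one,
  such as a diagonal matrix times a unitary one.\<close>

lemma vec_norm2_gram_cong:
  assumes "adj A * A = adj B * B" "x \<in> carrier_vec (dim_col A)" 
  shows "vec_norm2 (A *\<^sub>v x) = vec_norm2 (B *\<^sub>v x)"
proof -
  have "dim_col A = dim_col B"
    using arg_cong[OF assms(1), of dim_row] by simp
  then have "complex_of_real ((vec_norm2 (A *\<^sub>v x))\<^sup>2) = complex_of_real ((vec_norm2 (B *\<^sub>v x))\<^sup>2)"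
    using assms by (simp add: vec_norm2_gram del: of_real_power)
  then show ?thesis using power2_eq_imp_eq by (fastforce simp del: of_real_power)
qed

lemma vec_norm2_isometry:
  assumes "adj A * A = 1\<^sub>m n" "x \<in> carrier_vec n"
  shows "vec_norm2 (A *\<^sub>v x) = vec_norm2 x"
proof -
  have "dim_col A = n" using arg_cong[OF assms(1), of dim_row] by simp
  then show ?thesis using vec_norm2_gram_cong[of A "1\<^sub>m n" x] assms by simp
qed

lemma vec_norm2_append: "(vec_norm2 (v @\<^sub>v w))\<^sup>2 = (vec_norm2 v)\<^sup>2 + (vec_norm2 w)\<^sup>2"
proof -
  have "conjugate (v @\<^sub>v w) = conjugate v @\<^sub>v conjugate w"
    by (rule eq_vecI) auto
  then have "(v @\<^sub>v w) \<bullet>c (v @\<^sub>v w) = v \<bullet>c v + w \<bullet>c w"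
    by (metis carrier_vec_conjugate carrier_vec_dim_vec scalar_prod_append)
  then have "complex_of_real ((vec_norm2 (v @\<^sub>v w))\<^sup>2)
      = complex_of_real ((vec_norm2 v)\<^sup>2 + (vec_norm2 w)\<^sup>2)"
    by (simp only: vec_norm2_cscalar of_real_add)
  then show ?thesis by (simp only: of_real_eq_iff)
qed

lemma vec_norm2_smult: "vec_norm2 (c \<cdot>\<^sub>v v) = cmod c * vec_norm2 v"
  by (simp add: vec_norm2_def norm_mult power_mult_distrib sum_distrib_left[symmetric] real_sqrt_mult)

section \<open>The spectral theorem for Hermitian matrices\<close>

text \<open>The vector is extended to a basis, Gram-Schmidt makes the basis orthogonal while keeping
  \<open>v\<close> in first place, and a diagonal factor normalizes the columns.\<close>

lemma unitary_completion:
  assumes v: "v \<in> carrier_vec n" "v \<noteq> 0\<^sub>v n"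
  shows "\<exists>W c. unitary_mat n W \<and> col W 0 = c \<cdot>\<^sub>v v"
proof -
  interpret cof_vec_space n "TYPE(complex)" .
  define b where "b = basis_completion v"
  define ws where "ws = gram_schmidt n b"
  from basis_completion[OF v, folded b_def]
  have dist_b: "distinct b" and indep: "\<not> lin_dep (set b)" and b: "set b \<subseteq> carrier_vec n"
    and hdb: "hd b = v" and len_b: "length b = n" by auto
  have n: "n \<noteq> 0" using v by (metis carrier_vecD eq_vecI index_zero_vec(2) less_nat_zero_code)
  from hdb len_b n obtain vs where bv: "b = v # vs" by (cases b, auto)
  from gram_schmidt_result[OF b dist_b indep refl, folded ws_def]
  have ws: "set ws \<subseteq> carrier_vec n" "corthogonal ws" "length ws = n"
    by (auto simp: len_b)
  from gram_schmidt_hd[OF v(1), of vs, folded bv] have hdws: "hd ws = v" unfolding ws_def .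
  define W0 where "W0 = mat_of_cols n ws"
  have W0: "W0 \<in> carrier_mat n n" "dim_row W0 = n" "dim_col W0 = n" unfolding W0_def using ws by auto
  define g where "g i = vec_norm2 (ws ! i)" for i
  have wsi: "ws ! i \<in> carrier_vec n" if "i < n" for i using ws that by auto
  have cscal: "ws ! i \<bullet>c ws ! j = (if i = j then complex_of_real ((g i)\<^sup>2) else 0)" if "i < n" "j < n" for i j
    using corthogonalD[OF ws(2), of i j] ws(3) that by (auto simp: g_def vec_norm2_cscalar simp del: of_real_power)
  have g0: "g i \<noteq> 0" if "i < n" for i
    using corthogonalD[OF ws(2), of i i] ws(3) that cscal[of i i] by auto
  have gram: "adj W0 * W0 = mat_diag n (\<lambda>i. complex_of_real ((g i)\<^sup>2))"
  proof (rule eq_matI)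
    fix i j assume "i < dim_row (mat_diag n (\<lambda>i. complex_of_real ((g i)\<^sup>2)))"
      and "j < dim_col (mat_diag n (\<lambda>i. complex_of_real ((g i)\<^sup>2)))"
    then have ij: "i < n" "j < n" by auto
    have "(adj W0 * W0) $$ (i,j) = row (adj W0) i \<bullet> col W0 j"
      using ij W0 by simp
    also have "\<dots> = ws ! j \<bullet>c ws ! i"
      using ij wsi[OF ij(1)] wsi[OF ij(2)] ws(3)
      by (auto simp: scalar_prod_def W0_def conjugate_complex_def mat_of_cols_def intro!: sum.cong)
    finally show "(adj W0 * W0) $$ (i,j) = mat_diag n (\<lambda>i. complex_of_real ((g i)\<^sup>2)) $$ (i,j)"
      using cscal[OF ij(2,1)] ij by (auto simp: mat_diag_def)
  qed (use W0 in auto)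
  define E where "E = mat_diag n (\<lambda>i. complex_of_real (1 / g i))"
  define W where "W = W0 * E"
  have E: "E \<in> carrier_mat n n" "dim_row E = n" "dim_col E = n" "adj E = E"
    unfolding E_def by (auto simp: adj_diag)
  have W: "W \<in> carrier_mat n n" unfolding W_def using W0 E by auto
  have "adj W * W = E * ((adj W0 * W0) * E)"
    unfolding W_def using W0 E by (simp add: adj_mult mat_assoc)
  also have "\<dots> = mat_diag n (\<lambda>i. complex_of_real (1 / g i * ((g i)\<^sup>2 * (1 / g i))))"
    unfolding gram E_def by simp
  also have "\<dots> = mat_diag n (\<lambda>i. 1)"
    by (rule mat_diag_cong) (use g0 in \<open>auto simp: power2_eq_square\<close>)
  finally have "unitary_mat n W" using W by (simp add: unitary_mat_def)
  moreover have "col W 0 = complex_of_real (1 / g 0) \<cdot>\<^sub>v v"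
  proof (rule eq_vecI)
    fix i assume "i < dim_vec (complex_of_real (1 / g 0) \<cdot>\<^sub>v v)"
    then have i: "i < n" using v by auto
    have "ws \<noteq> []" using n ws by auto
    then have "ws ! 0 = v" using hdws hd_conv_nth[of ws] by simp
    then have "W0 $$ (i,0) = v $ i" using i n ws by (auto simp: W0_def mat_of_cols_def)
    then show "col W 0 $ i = (complex_of_real (1 / g 0) \<cdot>\<^sub>v v) $ i"
      using i n v W unfolding W_def E_def by (simp add: mat_diag_mult_right[OF W0(1)])
  qed (use W v in auto)
  ultimately show ?thesis by blast
qed

text \<open>Deflation: a unitary matrix with an eigenvector as first column splits off a one by one
  block, and Hermitian symmetry clears the rest of the first row. The order of \<open>es\<close> is
  arbitrary, which later allows the squared singular values to be listed in sorted order.\<close>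

lemma spectral_hermitian:
  assumes "A \<in> carrier_mat n n" "adj A = A" "char_poly A = (\<Prod>e\<leftarrow>es. [:- e, 1:])"
  shows "\<exists>P. unitary_mat n P \<and> A = P * mat_diag n (\<lambda>i. es ! i) * adj P"
  using assms
proof (induction es arbitrary: n A)
  case Nil
  then have "n = 0" using degree_monic_char_poly[of A n] by auto
  then show ?case using Nil by (intro exI[of _ "1\<^sub>m 0"]) (auto simp: unitary_one)
next
  case (Cons e es n A)
  note A = Cons.prems(1) and herm = Cons.prems(2)
  have cp: "char_poly A = [:- e, 1:] * (\<Prod>e\<leftarrow>es. [:- e, 1:])" using Cons.prems(3) by simp
  have e: "eigenvalue A e" unfolding eigenvalue_root_char_poly[OF A] cp by simp
  then obtain k where n: "n = Suc k" using eigenvalue_imp_nonzero_dim[OF A] by (cases n) auto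
  from find_eigenvector[OF A e] obtain v where v: "v \<in> carrier_vec n" "v \<noteq> 0\<^sub>v n" "A *\<^sub>v v = e \<cdot>\<^sub>v v"
    unfolding eigenvector_def using A by auto
  obtain W c where W: "unitary_mat n W" and Wv: "col W 0 = c \<cdot>\<^sub>v v"
    using unitary_completion[OF v(1,2)] by auto
  note WD = unitary_matD[OF W]
  define A' where "A' = adj W * A * W"
  have A': "A' \<in> carrier_mat n n" "dim_row A' = n" "dim_col A' = n" using A WD by (auto simp: A'_def)
  have A'eq: "A = W * A' * adj W"
    unfolding A'_def using A WD
    by (simp add: mat_assoc mult_cancel_left_inverse[of W "adj W" n])
  have hermA': "adj A' = A'"
    unfolding A'_def using A WD herm by (simp add: adj_mult mat_assoc)
  have "similar_mat A' A"
    by (rule similar_matI[of _ _ "adj W" W n]) (use A A' WD in \<open>auto simp: A'_def\<close>)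
  note cpA' = char_poly_similar[OF this]
  have "col A' 0 = e \<cdot>\<^sub>v unit_vec n 0"
  proof -
    have "A' = adj W * (A * W)"
      unfolding A'_def using A WD by (intro mat_assoc) auto
    also have "col \<dots> 0 = adj W *\<^sub>v col (A * W) 0"
      by (rule col_mult2[of _ n n _ n]) (use A WD n in auto)
    also have "col (A * W) 0 = A *\<^sub>v col W 0"
      by (rule col_mult2[of _ n n _ n]) (use A WD n in auto)
    also have "A *\<^sub>v col W 0 = e \<cdot>\<^sub>v col W 0"
      unfolding Wv using A v mult_mat_vec[OF A v(1)] by (auto simp: smult_smult_assoc mult.commute)
    also have "adj W *\<^sub>v (e \<cdot>\<^sub>v col W 0) = e \<cdot>\<^sub>v (adj W *\<^sub>v col W 0)"
      by (rule mult_mat_vec[of _ n n]) (use WD in \<open>auto intro!: carrier_vecI\<close>)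
    also have "adj W *\<^sub>v col W 0 = col (adj W * W) 0"
      using WD n by (intro col_mult2[symmetric, of _ n n _ n]) auto
    finally show ?thesis using WD n by simp
  qed
  then have col0: "A' $$ (i, 0) = (if i = 0 then e else 0)" if "i < n" for i
    using that n A' by (metis (no_types, lifting) index_col index_smult_vec(1) index_unit_vec(1,3) mult.right_neutral
        mult_zero_right zero_less_Suc)
  have row0: "A' $$ (0, j) = 0" if "0 < j" "j < n" for j
  proof -
    have "A' $$ (0, j) = cnj (A' $$ (j, 0))"
      using hermA' that A' n by (metis adj_index zero_less_Suc)
    then show ?thesis using col0[of j] that by simp
  qed
  define B where "B = mat k k (\<lambda>(i,j). A' $$ (Suc i, Suc j))"
  have B: "B \<in> carrier_mat k k" by (simp add: B_def)
  define e1 where "e1 = mat 1 1 (\<lambda>_::nat \<times> nat. e)"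
  have e1: "e1 \<in> carrier_mat 1 1" by (simp add: e1_def)
  have A'B: "A' = four_block_mat e1 (0\<^sub>m 1 k) (0\<^sub>m k 1) B"
    using A' n by (intro eq_matI) (auto simp: B_def e1_def col0 row0)
  have hermB: "adj B = B"
  proof (rule eq_matI)
    fix i j assume "i < dim_row B" "j < dim_col B"
    moreover from this have "A' $$ (Suc i, Suc j) = cnj (A' $$ (Suc j, Suc i))"
      using hermA' A' n B by (metis adj_index carrier_matD not_less_eq)
    ultimately show "adj B $$ (i, j) = B $$ (i, j)" using B by (auto simp: B_def)
  qed (use B in auto)
  \<comment> \<open>The linear factor of the split-off entry cancels, leaving for the smaller block
    exactly the factorization over \<open>es\<close> that the induction hypothesis expects.\<close>
  have "[:- e, 1:] * (\<Prod>e\<leftarrow>es. [:- e, 1:]) = char_poly e1 * char_poly B"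
    using char_poly_four_block_zeros_col[OF e1 _ B, of "0\<^sub>m 1 k"] cp cpA' by (simp add: A'B)
  also have "char_poly e1 = [:- e, 1:]"
    by (simp add: e1_def char_poly_defs det_def sign_def)
  finally have "char_poly B = (\<Prod>e\<leftarrow>es. [:- e, 1:])"
    by (metis mult_cancel_left pCons_eq_0_iff zero_neq_one)
  from Cons.IH[OF B hermB this] obtain P where P: "unitary_mat k P"
    and BP: "B = P * mat_diag k (\<lambda>i. es ! i) * adj P" by auto
  note PD = unitary_matD[OF P]
  define F where "F = four_block_mat (1\<^sub>m 1) (0\<^sub>m 1 k) (0\<^sub>m k 1) P"
  have F: "F \<in> carrier_mat n n" "dim_row F = n" "dim_col F = n" using PD n by (auto simp: F_def)
  have adjF: "adj F = four_block_mat (1\<^sub>m 1) (0\<^sub>m 1 k) (0\<^sub>m k 1) (adj P)"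
    unfolding F_def using PD by (subst adj_four_block[of _ 1 1 _ k _ k]) auto
  have "adj F * F = four_block_mat (1\<^sub>m 1) (0\<^sub>m 1 k) (0\<^sub>m k 1) (1\<^sub>m k)"
    unfolding adjF unfolding F_def using PD
    by (subst mult_four_block_mat[of _ 1 1 _ k _ k _ _ 1 _ k]) auto
  then have F_unitary: "unitary_mat n F" using F n by (simp add: unitary_mat_def)
  have D: "mat_diag n (\<lambda>i. (e # es) ! i)
      = four_block_mat e1 (0\<^sub>m 1 k) (0\<^sub>m k 1) (mat_diag k (\<lambda>i. es ! i))"
    using n by (intro eq_matI) (auto simp: mat_diag_def e1_def nth_Cons split: nat.splits)
  have "F * mat_diag n (\<lambda>i. (e # es) ! i) * adj F
    = four_block_mat e1 (0\<^sub>m 1 k) (0\<^sub>m k 1) B"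
    unfolding D adjF BP unfolding F_def using PD e1
    apply (subst mult_four_block_mat[of _ 1 1 _ k _ k _ _ 1 _ k]; (simp; fail)?)
    apply (subst mult_four_block_mat[of _ 1 1 _ k _ k _ _ 1 _ k]; (simp; fail)?)
    done
  then have "A' = F * mat_diag n (\<lambda>i. (e # es) ! i) * adj F" using A'B by simp
  then have "A = (W * F) * mat_diag n (\<lambda>i. (e # es) ! i) * adj (W * F)"
    using A'eq WD F by (simp add: adj_mult mat_assoc)
  then show ?case using unitary_mult[OF W F_unitary] by blast
qed

text \<open>Both polynomials at \<open>k\<close> are determinants of one block matrix with rows
  \<open>(k, X)\<close> and \<open>(Y, 1)\<close>, before and after \<open>J\<close> swaps its block
  rows and columns. The result gives a square matrix and its adjoint the same singular
  values.\<close>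

lemma char_poly_mult_commute:
  fixes X Y :: "complex mat"
  assumes X: "X \<in> carrier_mat n n" and Y: "Y \<in> carrier_mat n n"
  shows "char_poly (X * Y) = char_poly (Y * X)"
proof -
  have "poly (char_poly (X * Y)) k = poly (char_poly (Y * X)) k" for k
  proof -
    define K where "K = k \<cdot>\<^sub>m 1\<^sub>m n"
    have K: "K \<in> carrier_mat n n" by (simp add: K_def)
    define J where "J = four_block_mat (0\<^sub>m n n) (1\<^sub>m n) (1\<^sub>m n) (0\<^sub>m n n :: complex mat)"
    have J: "J \<in> carrier_mat (n + n) (n + n)" by (simp add: J_def)
    have cm: "- char_matrix M k = K - M" if "M \<in> carrier_mat n n" for M
      using that by (intro eq_matI) (auto simp: char_matrix_def K_def)
    define M where "M = four_block_mat K X Y (1\<^sub>m n)"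
    have M: "M \<in> carrier_mat (n + n) (n + n)" using K X Y by (simp add: M_def)
    have JJ: "J * J = 1\<^sub>m (n + n)"
      unfolding J_def by (subst mult_four_block_mat[of _ n n _ n _ n _ _ n _ n]) auto
    have "J * M * J = four_block_mat (1\<^sub>m n) Y X K"
      unfolding J_def M_def using K X Y
      apply (subst mult_four_block_mat[of _ n n _ n _ n _ _ n _ n]; (simp; fail)?)
      apply (subst mult_four_block_mat[of _ n n _ n _ n _ _ n _ n]; (simp; fail)?)
      done
    then have "det (four_block_mat (1\<^sub>m n) Y X K) = det J * det M * det J"
      using J M by (metis det_mult mult_carrier_mat)
    also have "\<dots> = det M" using det_mult[OF J J] JJ by (simp add: algebra_simps)
    finally have *: "det (four_block_mat (1\<^sub>m n) Y X K) = det M" .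
    have XK: "X * K = K * X" unfolding K_def using X by (metis left_mult_one_mat mult_smult_assoc_mat mult_smult_distrib one_carrier_mat right_mult_one_mat)
    have "poly (char_poly (X * Y)) k = det (K - X * Y)"
      using X Y by (simp add: char_poly_matrix[of "X * Y" n] cm)
    also have "\<dots> = det M"
      unfolding M_def using det_four_block_mat[OF K X Y one_carrier_mat] K X Y by simp
    also have "\<dots> = det (K - Y * X)"
      using det_four_block_mat[OF one_carrier_mat Y X K XK] K X Y * by simp
    also have "\<dots> = poly (char_poly (Y * X)) k"
      using X Y by (simp add: char_poly_matrix[of "Y * X" n] cm)
    finally show ?thesis .
  qed
  then show ?thesis using poly_eq_poly_eq_iff by blast
qed

section \<open>Singular values and operator bounds\<close>

lemma proots_prod_linear:
  fixes es :: "'a :: idom list"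
  shows "proots (\<Prod>e\<leftarrow>es. [:- e, 1:]) = mset es"
proof (induction es)
  case (Cons e es)
  have "(\<Prod>e\<leftarrow>es. [:- e, 1:]) \<noteq> 0" by (auto simp: prod_list_zero_iff)
  then show ?case using Cons proots_linear_factor[of "- e"] by (simp add: proots_mult del: mult_pCons_left)
qed simp

text \<open>Diagonal entries of a Gram matrix are squared column lengths. This yields the reality
  and nonnegativity of the eigenvalues, and the vanishing of columns that belong to zero
  entries.\<close>

lemma gram_diag_entry:
  assumes "adj Q * Q = mat_diag n f" "i < n"
  shows "f i = complex_of_real ((vec_norm2 (col Q i))\<^sup>2)"
proof -
  have n: "dim_col Q = n" using arg_cong[OF assms(1), of dim_row] by simp
  have "f i = (adj Q * Q) $$ (i,i)" using assms by (simp add: mat_diag_def)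
  also have "\<dots> = col Q i \<bullet>c col Q i"
    using assms(2) n by (auto simp: scalar_prod_def conjugate_complex_def intro!: sum.cong)
  finally show ?thesis by (simp only: vec_norm2_cscalar)
qed

text \<open>The list \<open>\<sigma>\<close> holds the roots of all \<open>n\<close> eigenvalues of
  the Gram matrix, so it is longer than \<open>sing_vals M\<close> when \<open>m < n\<close>.
  Expansions of a vector in the columns of \<open>P\<close> run over all of
  \<open>\<sigma>\<close>.\<close>

lemma singular_value_decomposition:
  assumes M: "M \<in> carrier_mat m n"
  obtains P \<sigma> where "unitary_mat n P" "length \<sigma> = n" "sorted_wrt (\<ge>) \<sigma>" "\<And>i. i < n \<Longrightarrow> 0 \<le> \<sigma> ! i"
    "adj M * M = P * mat_diag n (\<lambda>i. complex_of_real ((\<sigma> ! i)\<^sup>2)) * adj P"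
    "sing_vals M = take (min m n) \<sigma>"
proof -
  define G where "G = adj M * M"
  have G: "G \<in> carrier_mat n n" using M by (auto simp: G_def)
  have herm: "adj G = G" unfolding G_def by (simp add: adj_mult)
  obtain es where es: "char_poly G = (\<Prod>e\<leftarrow>es. [:- e, 1:])" "length es = n"
    using char_poly_factorized[OF G] by auto
  obtain P0 where P0: "unitary_mat n P0" "G = P0 * mat_diag n (\<lambda>i. es ! i) * adj P0"
    using spectral_hermitian[OF G herm es(1)] by auto
  note D = unitary_matD[OF P0(1)]
  have "adj (M * P0) * (M * P0) = adj P0 * G * P0"
    unfolding G_def using M D by (simp add: adj_mult mat_assoc)
  also have "\<dots> = mat_diag n (\<lambda>i. es ! i)"
    unfolding P0(2) using D by (simp add: mat_assoc mult_cancel_left_inverse[of "adj P0" P0 n])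
  finally have "es ! i = complex_of_real ((vec_norm2 (col (M * P0) i))\<^sup>2)" if "i < n" for i
    using gram_diag_entry that by blast
  \<comment> \<open>Eigenvalues of a Gram matrix are nonnegative reals, so taking the real part and
    then the root loses nothing.\<close>
  then have es_sqrt: "complex_of_real ((sqrt (Re z))\<^sup>2) = z" if "z \<in> set es" for z
    using that es(2) by (auto simp: in_set_conv_nth simp flip: of_real_power)
  define \<sigma> where "\<sigma> = rev (sorted_list_of_multiset (image_mset (\<lambda>z. sqrt (Re z)) (mset es)))"
  have mset_\<sigma>: "mset \<sigma> = image_mset (\<lambda>z. sqrt (Re z)) (mset es)" by (simp add: \<sigma>_def)
  have len: "length \<sigma> = n" using arg_cong[OF mset_\<sigma>, of size] es(2) by simp
  have sorted: "sorted_wrt (\<ge>) \<sigma>"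
    unfolding \<sigma>_def sorted_wrt_rev by (simp add: sorted_sorted_list_of_multiset)
  have "set \<sigma> = (\<lambda>z. sqrt (Re z)) ` set es" using arg_cong[OF mset_\<sigma>, of set_mset] by simp
  moreover have "0 \<le> Re z" if "z \<in> set es" for z
    using es_sqrt[OF that] by (metis Re_complex_of_real zero_le_power2)
  ultimately have "0 \<le> x" if "x \<in> set \<sigma>" for x using that by auto
  then have nonneg: "0 \<le> \<sigma> ! i" if "i < n" for i using len that by simp
  \<comment> \<open>\<open>es'\<close> is \<open>es\<close> rearranged in descending order. The
    product of linear factors is unchanged, so the spectral theorem applies again with this
    order.\<close>
  define es' where "es' = map (\<lambda>s. complex_of_real (s\<^sup>2)) \<sigma>"
  have "mset es' = image_mset (\<lambda>s. complex_of_real (s\<^sup>2)) (mset \<sigma>)" by (simp add: es'_def)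
  also have "\<dots> = image_mset (\<lambda>z. complex_of_real ((sqrt (Re z))\<^sup>2)) (mset es)"
    unfolding mset_\<sigma> by (simp add: image_mset.compositionality comp_def)
  also have "\<dots> = image_mset (\<lambda>z. z) (mset es)"
    by (rule image_mset_cong) (simp add: es_sqrt del: of_real_power)
  finally have "mset es' = mset es" by simp
  then have "(\<Prod>e\<leftarrow>es'. [:- e, 1:]) = (\<Prod>e\<leftarrow>es. [:- e, 1:])"
    by (metis mset_map prod_mset_prod_list)
  then obtain P where P: "unitary_mat n P" "G = P * mat_diag n (\<lambda>i. es' ! i) * adj P"
    using spectral_hermitian[OF G herm, of es'] es(1) by auto
  have "mat_diag n (\<lambda>i. es' ! i) = mat_diag n (\<lambda>i. complex_of_real ((\<sigma> ! i)\<^sup>2))"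
    by (rule mat_diag_cong) (simp add: es'_def len)
  then have "adj M * M = P * mat_diag n (\<lambda>i. complex_of_real ((\<sigma> ! i)\<^sup>2)) * adj P"
    using P(2) by (simp add: G_def)
  moreover have "sing_vals M = take (min m n) \<sigma>"
    unfolding sing_vals_def \<sigma>_def using M es(1) by (simp add: G_def proots_prod_linear)
  ultimately show ?thesis using that P(1) len sorted nonneg by blast
qed

text \<open>With \<open>E\<close> the diagonal of the \<open>\<sigma> i\<close>, the matrix
  \<open>E * adj P\<close> has the same Gram matrix as \<open>M\<close>, and it merely scales the
  coordinates of \<open>x\<close> in the columns of \<open>P\<close>.\<close>

lemma singular_value_norm:
  assumes "unitary_mat n P" "adj M * M = P * mat_diag n (\<lambda>i. complex_of_real ((\<sigma> i)\<^sup>2)) * adj P"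
    and "x \<in> carrier_vec n"
  shows "(vec_norm2 (M *\<^sub>v x))\<^sup>2 = (\<Sum>i<n. (\<sigma> i)\<^sup>2 * (cmod ((adj P *\<^sub>v x) $ i))\<^sup>2)"
    and "(vec_norm2 x)\<^sup>2 = (\<Sum>i<n. (cmod ((adj P *\<^sub>v x) $ i))\<^sup>2)"
proof -
  note D = unitary_matD[OF assms(1)]
  define E where "E = mat_diag n (\<lambda>i. complex_of_real (\<sigma> i))"
  have E: "dim_row E = n" "dim_col E = n" "adj E = E" "E \<in> carrier_mat n n" by (auto simp: E_def adj_diag)
  have "dim_col M = n" using arg_cong[OF assms(2), of dim_row] D by simp
  moreover have "adj M * M = adj (E * adj P) * (E * adj P)"
  proof -
    have "adj (E * adj P) * (E * adj P) = P * (E * E) * adj P"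
      using D E by (simp add: adj_mult mat_assoc)
    also have "E * E = mat_diag n (\<lambda>i. complex_of_real ((\<sigma> i)\<^sup>2))"
      by (simp add: E_def power2_eq_square)
    finally show ?thesis using assms(2) by simp
  qed
  ultimately have "vec_norm2 (M *\<^sub>v x) = vec_norm2 ((E * adj P) *\<^sub>v x)"
    using vec_norm2_gram_cong[of M "E * adj P" x] assms(3) by simp
  also have "(E * adj P) *\<^sub>v x = E *\<^sub>v (adj P *\<^sub>v x)"
    by (rule assoc_mult_mat_vec[of _ n n _ n]) (use D E assms in auto)
  also have "\<dots> = vec n (\<lambda>i. complex_of_real (\<sigma> i) * (adj P *\<^sub>v x) $ i)"
  proof (rule eq_vecI)
    fix i assume "i < dim_vec (vec n (\<lambda>i. complex_of_real (\<sigma> i) * (adj P *\<^sub>v x) $ i))"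
    then have i: "i < n" by simp
    then have "(E *\<^sub>v (adj P *\<^sub>v x)) $ i = (\<Sum>j\<in>{0..<n}. E $$ (i,j) * (adj P *\<^sub>v x) $ j)"
      using E D by (auto simp: scalar_prod_def simp del: index_mult_mat_vec intro!: sum.cong) (simp add: scalar_prod_def)
    also have "\<dots> = (\<Sum>j\<in>{0..<n}. if j = i then complex_of_real (\<sigma> i) * (adj P *\<^sub>v x) $ i else 0)"
      using i by (intro sum.cong) (auto simp: E_def mat_diag_def)
    finally show "(E *\<^sub>v (adj P *\<^sub>v x)) $ i = vec n (\<lambda>i. complex_of_real (\<sigma> i) * (adj P *\<^sub>v x) $ i) $ i"
      using i by simp
  qed (use E in auto)
  finally show "(vec_norm2 (M *\<^sub>v x))\<^sup>2 = (\<Sum>i<n. (\<sigma> i)\<^sup>2 * (cmod ((adj P *\<^sub>v x) $ i))\<^sup>2)"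
    by (simp add: vec_norm2_sq norm_mult power_mult_distrib)
  have "vec_norm2 (adj P *\<^sub>v x) = vec_norm2 x"
    by (rule vec_norm2_isometry[of _ n]) (use D assms in auto)
  then show "(vec_norm2 x)\<^sup>2 = (\<Sum>i<n. (cmod ((adj P *\<^sub>v x) $ i))\<^sup>2)"
    using D by (metis adj_dim(1) dim_mult_mat_vec vec_norm2_sq)
qed

lemma sing_vals_adj_square:
  assumes "M \<in> carrier_mat n n"
  shows "sing_vals (adj M) = sing_vals M"
  using char_poly_mult_commute[of M n "adj M"] assms by (simp add: sing_vals_def)

text \<open>A bound for the operator norm in place of its value: it passes to blocks, isometries and
  single columns by comparing lengths, without computing any singular values.\<close>

definition op_bound :: "real \<Rightarrow> complex mat \<Rightarrow> bool" where
  "op_bound s C \<longleftrightarrow> 0 \<le> s \<and> (\<forall>x\<in>carrier_vec (dim_col C). vec_norm2 (C *\<^sub>v x) \<le> s * vec_norm2 x)"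

lemma spec_norm_nonneg: "0 \<le> spec_norm M"
  unfolding spec_norm_def by simp

lemma op_bound_spec_norm: "op_bound (spec_norm C) C"
  unfolding op_bound_def
proof (intro conjI ballI)
  fix x :: "complex vec" assume x: "x \<in> carrier_vec (dim_col C)"
  define m n where "m = dim_row C" and "n = dim_col C"
  have C: "C \<in> carrier_mat m n" by (auto simp: m_def n_def)
  obtain P \<sigma> where P: "unitary_mat n P" and len: "length \<sigma> = n" and sorted: "sorted_wrt (\<ge>) \<sigma>"
    and nonneg: "\<And>i. i < n \<Longrightarrow> 0 \<le> \<sigma> ! i"
    and dec: "adj C * C = P * mat_diag n (\<lambda>i. complex_of_real ((\<sigma> ! i)\<^sup>2)) * adj P"
    and sv: "sing_vals C = take (min m n) \<sigma>"
    using singular_value_decomposition[OF C] by blast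
  \<comment> \<open>For \<open>m = 0\<close> the list \<open>sing_vals C\<close> is empty and says
    nothing about \<open>\<sigma> ! 0\<close>; the image of \<open>x\<close> is then the empty
    vector.\<close>
  show "vec_norm2 (C *\<^sub>v x) \<le> spec_norm C * vec_norm2 x"
  proof (cases "m = 0")
    case True
    then show ?thesis using spec_norm_nonneg[of C] C by (simp add: vec_norm2_def sum_nonneg)
  next
    case False
    have "\<sigma> ! i \<le> spec_norm C" if "i < n" for i
    proof -
      have "\<sigma> ! i \<le> \<sigma> ! 0"
        using sorted that len by (cases "i = 0") (auto simp: sorted_wrt_iff_nth_less)
      also have "\<sigma> ! 0 \<in> set (sing_vals C)"
        using False that len nth_mem[of 0 "take (min m n) \<sigma>"] by (simp add: sv)
      then have "\<sigma> ! 0 \<le> spec_norm C" unfolding spec_norm_def by (intro Max_ge) auto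
      finally show ?thesis .
    qed
    then have "(vec_norm2 (C *\<^sub>v x))\<^sup>2 \<le> (\<Sum>i<n. (spec_norm C)\<^sup>2 * (cmod ((adj P *\<^sub>v x) $ i))\<^sup>2)"
      using x by (subst singular_value_norm(1)[OF P dec])
        (auto simp: n_def intro!: sum_mono mult_right_mono power_mono nonneg)
    also have "\<dots> = (spec_norm C * vec_norm2 x)\<^sup>2"
      using singular_value_norm(2)[OF P dec] x by (simp add: n_def power_mult_distrib sum_distrib_left)
    finally show ?thesis
      using spec_norm_nonneg[of C] by (simp add: power2_le_iff_abs_le)
  qed
qed (rule spec_norm_nonneg)

text \<open>Each eigenvalue $s\cos\theta$ is the average of $s e^{i\theta}$ and $s e^{-i\theta}$.\<close>
lemma hermitian_average_of_unitaries:
  assumes H: "H \<in> carrier_mat n n" "adj H = H" and s: "0 \<le> s"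
    and bound: "\<And>v c. v \<in> carrier_vec n \<Longrightarrow> v \<noteq> 0\<^sub>v n \<Longrightarrow> H *\<^sub>v v = c \<cdot>\<^sub>v v \<Longrightarrow> cmod c \<le> s"
  shows "\<exists>W1 W2. unitary_mat n W1 \<and> unitary_mat n W2 \<and> H = complex_of_real (s / 2) \<cdot>\<^sub>m (W1 + W2)"
proof -
  obtain es where es: "char_poly H = (\<Prod>e\<leftarrow>es. [:- e, 1:])" "length es = n"
    using char_poly_factorized[OF H(1)] by auto
  obtain P where P: "unitary_mat n P" "H = P * mat_diag n (\<lambda>i. es ! i) * adj P"
    using spectral_hermitian[OF H es(1)] by auto
  note D = unitary_matD[OF P(1)]
  let ?E = "mat_diag n (\<lambda>i. es ! i)"
  have "adj P * H * P = ?E"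
    unfolding P(2) using D by (simp add: mat_assoc mult_cancel_left_inverse[of "adj P" P n])
  moreover have "adj (adj P * H * P) = adj P * H * P"
    using D H by (simp add: adj_mult mat_assoc)
  ultimately have herm: "adj ?E = ?E" by simp
  have "cnj (es ! i) = es ! i" if "i < n" for i
    using arg_cong[OF herm, of "\<lambda>M. M $$ (i,i)"] that unfolding adj_diag by (simp add: mat_diag_def)
  then have real: "es ! i = complex_of_real (Re (es ! i))" if "i < n" for i
    using that by (simp add: complex_eq_iff)
  have le: "cmod (es ! i) \<le> s" if i: "i < n" for i
  proof (rule bound)
    show c: "col P i \<in> carrier_vec n" using D by (intro carrier_vecI) simp
    have "complex_of_real ((vec_norm2 (col P i))\<^sup>2) = 1"
      using gram_diag_entry[of P n "\<lambda>_. 1" i] D i by simp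
    then show "col P i \<noteq> 0\<^sub>v n" using vec_norm2_eq_0[of "col P i"] D by auto
    have "H * P = P * ?E"
      unfolding P(2) using D by (simp add: mat_assoc)
    then have "col (H * P) i = col (P * ?E) i" by simp
    moreover have "col (H * P) i = H *\<^sub>v col P i" using H D i by (intro col_mult2[of _ n n _ n]) auto
    moreover have "col (P * ?E) i = es ! i \<cdot>\<^sub>v col P i"
      unfolding mat_diag_mult_right[OF D(1)] using D i by (intro eq_vecI) auto
    ultimately show "H *\<^sub>v col P i = es ! i \<cdot>\<^sub>v col P i" by simp
  qed
  \<comment> \<open>For \<open>s = 0\<close> the quotient is 0 by the convention on division. The
    eigenvalue vanishes as well, so \<open>s * cos (t i)\<close> still is its value.\<close>
  define t where "t i = arccos (Re (es ! i) / s)" for i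
  have t: "s * cos (t i) = Re (es ! i)" if "i < n" for i
  proof (cases "s = 0")
    case True
    then show ?thesis using le[OF that] by simp
  next
    case False
    then have "s > 0" using s by simp
    moreover have "\<bar>Re (es ! i)\<bar> \<le> s" using le[OF that] abs_Re_le_cmod order_trans by blast
    ultimately have "-1 \<le> Re (es ! i) / s" "Re (es ! i) / s \<le> 1" by (auto simp: field_simps abs_le_iff)
    then show ?thesis using False by (simp add: t_def)
  qed
  define W where "W r = P * mat_diag n (\<lambda>i. cis (r * t i)) * adj P" for r :: real
  have W: "unitary_mat n (W r)" for r
  proof -
    have "unitary_mat n (mat_diag n (\<lambda>i. cis (r * t i)))"
      unfolding unitary_mat_def by (simp add: adj_diag cis_cnj cis_mult)
    then show ?thesis unfolding W_def by (intro unitary_mult P(1) unitary_adj)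
  qed
  have "W 1 + W (-1) = P * (mat_diag n (\<lambda>i. cis (1 * t i)) + mat_diag n (\<lambda>i. cis (-1 * t i))) * adj P"
    unfolding W_def using D by (simp add: mat_distrib)
  then have "complex_of_real (s / 2) \<cdot>\<^sub>m (W 1 + W (-1))
    = P * (complex_of_real (s / 2) \<cdot>\<^sub>m (mat_diag n (\<lambda>i. cis (1 * t i)) + mat_diag n (\<lambda>i. cis (-1 * t i)))) * adj P"
    using D by (simp add: mult_smult_distrib[of _ n n _ n] mult_smult_assoc_mat[of _ n n _ n])
  also have "complex_of_real (s / 2) \<cdot>\<^sub>m (mat_diag n (\<lambda>i. cis (1 * t i)) + mat_diag n (\<lambda>i. cis (-1 * t i))) = ?E"
    by (rule eq_matI) (use real t in \<open>auto simp: mat_diag_def complex_eq_iff\<close>)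
  finally have "H = complex_of_real (s / 2) \<cdot>\<^sub>m (W 1 + W (-1))" using P(2) by simp
  then show ?thesis using W by blast
qed

section \<open>Block matrices and ideal properties of unitarily invariant norms\<close>

lemma append_rows_dim [simp]:
  "dim_row (A @\<^sub>r B) = dim_row A + dim_row B" "dim_col (A @\<^sub>r B) = dim_col A"
  by (simp_all add: append_rows_def)

lemma append_rows_index [simp]:
  "i < dim_row A + dim_row B \<Longrightarrow> j < dim_col A \<Longrightarrow>
    (A @\<^sub>r B) $$ (i,j) = (if i < dim_row A then A $$ (i,j) else B $$ (i - dim_row A, j))"
  by (simp add: append_rows_def)

lemma append_cols_dim [simp]:
  "dim_row (append_cols A B) = dim_row A" "dim_col (append_cols A B) = dim_col A + dim_col B"
  by (simp_all add: append_cols_def)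

lemma append_cols_index [simp]:
  "i < dim_row A \<Longrightarrow> j < dim_col A + dim_col B \<Longrightarrow>
    append_cols A B $$ (i,j) = (if j < dim_col A then A $$ (i,j) else B $$ (i, j - dim_col A))"
  by (simp add: append_cols_def)

lemma append_rows_inject:
  assumes "A @\<^sub>r B = C @\<^sub>r D" "dim_row A = dim_row C" "dim_col A = dim_col B" "dim_col C = dim_col D"
  shows "A = C" "B = D"
proof -
  have dims: "dim_row B = dim_row D" "dim_col A = dim_col C"
    using arg_cong[OF assms(1), of dim_row] arg_cong[OF assms(1), of dim_col] assms(2) by auto
  have ix: "(A @\<^sub>r B) $$ (i,j) = (C @\<^sub>r D) $$ (i,j)" for i j using assms(1) by simp
  show "A = C"
  proof (rule eq_matI)
    fix i j assume "i < dim_row C" "j < dim_col C"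
    then show "A $$ (i,j) = C $$ (i,j)" using ix[of i j] dims assms(2) by simp
  qed (use dims assms in auto)
  show "B = D"
  proof (rule eq_matI)
    fix i j assume "i < dim_row D" "j < dim_col D"
    then show "B $$ (i,j) = D $$ (i,j)" using ix[of "i + dim_row A" j] dims assms(2-) by simp
  qed (use dims assms in auto)
qed

lemma append_rows_assoc: "dim_col A = dim_col B \<Longrightarrow> (A @\<^sub>r B) @\<^sub>r C = A @\<^sub>r (B @\<^sub>r C)"
  by (rule eq_matI) (auto simp: not_less)

lemma append_rows_add:
  fixes A :: "'a :: monoid_add mat"
  assumes "dim_row A = dim_row C" "dim_row B = dim_row D" "dim_col C = dim_col D" "dim_col A = dim_col C"
  shows "(A @\<^sub>r B) + (C @\<^sub>r D) = (A + C) @\<^sub>r (B + D)"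
  using assms by (intro eq_matI) auto

lemma append_cols_adj: "dim_row A = dim_row B \<Longrightarrow> adj (append_cols A B) = adj A @\<^sub>r adj B"
  by (rule eq_matI) auto

lemma append_rows_adj: "dim_col A = dim_col B \<Longrightarrow> adj (A @\<^sub>r B) = append_cols (adj A) (adj B)"
  by (rule eq_matI) auto

lemma append_rows_mult:
  fixes A :: "'a :: semiring_0 mat"
  assumes "dim_col A = dim_row C" "dim_col B = dim_row C"
  shows "(A @\<^sub>r B) * C = (A * C) @\<^sub>r (B * C)"
  using assms by (intro eq_matI) (auto simp: scalar_prod_def not_less intro!: sum.cong)

lemma mult_append_cols:
  fixes A :: "'a :: semiring_0 mat"
  assumes "dim_col C = dim_row A" "dim_row B = dim_row A"
  shows "C * append_cols A B = append_cols (C * A) (C * B)"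
  using assms by (intro eq_matI) (auto simp: scalar_prod_def not_less intro!: sum.cong)

lemma append_cols_mult_rows:
  fixes A :: "'a :: semiring_0 mat"
  assumes "dim_col A = dim_row C" "dim_col B = dim_row D" "dim_row A = dim_row B" "dim_col C = dim_col D"
  shows "append_cols A B * (C @\<^sub>r D) = A * C + B * D"
proof -
  \<comment> \<open>Both factors are read as two by two block matrices with empty blocks, so that
    the general block product applies.\<close>
  have "append_cols A B * (C @\<^sub>r D) = four_block_mat (A * C + B * D) (0\<^sub>m (dim_row A) 0) (0\<^sub>m 0 (dim_col C)) (0\<^sub>m 0 0)"
    unfolding append_cols_def append_rows_def
    by (subst mult_four_block_mat[of _ "dim_row A" "dim_col A" _ "dim_col B" _ 0 _ _ "dim_col C" _ 0]) (use assms in auto)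
  also have "\<dots> = A * C + B * D" using assms by (intro eq_matI) auto
  finally show ?thesis .
qed

lemma four_block_rows:
  assumes "dim_row A = dim_row B" "dim_col A = dim_col C" "dim_row C = dim_row D" "dim_col B = dim_col D"
  shows "four_block_mat A B C D = append_cols A B @\<^sub>r append_cols C D"
  using assms by (intro eq_matI) auto

lemma four_block_mult_rows:
  fixes A :: "'a :: semiring_0 mat"
  assumes "dim_row A = dim_row B" "dim_col A = dim_col C" "dim_row C = dim_row D" "dim_col B = dim_col D"
    and "dim_col A = dim_row X" "dim_col B = dim_row Y" "dim_col X = dim_col Y"
  shows "four_block_mat A B C D * (X @\<^sub>r Y) = (A * X + B * Y) @\<^sub>r (C * X + D * Y)"
  using assms by (simp add: four_block_rows append_rows_mult append_cols_mult_rows)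

lemma mult_four_block_cols:
  fixes A :: "'a :: semiring_0 mat"
  assumes "dim_row A = dim_row B" "dim_col A = dim_col C" "dim_row C = dim_row D" "dim_col B = dim_col D"
    and "dim_col X = dim_row A" "dim_col Y = dim_row C" "dim_row X = dim_row Y"
  shows "append_cols X Y * four_block_mat A B C D = append_cols (X * A + Y * C) (X * B + Y * D)"
proof -
  have "append_cols X Y * four_block_mat A B C D = append_cols (X * A) (X * B) + append_cols (Y * C) (Y * D)"
    using assms by (simp add: four_block_rows append_cols_mult_rows mult_append_cols)
  also have "\<dots> = append_cols (X * A + Y * C) (X * B + Y * D)"
    using assms by (intro eq_matI) auto
  finally show ?thesis .
qed

lemma append_rows_gram:
  "dim_col A = dim_col B \<Longrightarrow> adj (A @\<^sub>r B) * (A @\<^sub>r B) = adj A * A + adj B * B"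
  by (simp add: append_rows_adj append_cols_mult_rows)

lemma append_rows_mult_vec_norm:
  assumes "x \<in> carrier_vec (dim_col A)" "dim_col B = dim_col A"
  shows "(vec_norm2 ((A @\<^sub>r B) *\<^sub>v x))\<^sup>2 = (vec_norm2 (A *\<^sub>v x))\<^sup>2 + (vec_norm2 (B *\<^sub>v x))\<^sup>2"
proof -
  have "(A @\<^sub>r B) *\<^sub>v x = (A *\<^sub>v x) @\<^sub>v (B *\<^sub>v x)"
    by (rule mat_mult_append[of A "dim_row A" "dim_col A" B "dim_row B"]) (use assms in auto)
  then show ?thesis by (simp add: vec_norm2_append)
qed

text \<open>Squared lengths add over stacked blocks, so the image under one block is never longer
  than the image under the stack. In this way every block of an isometry becomes a
  contraction.\<close>

lemma op_bound_append_rowsD: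
  assumes "op_bound s (A @\<^sub>r B)" "dim_col B = dim_col A"
  shows "op_bound s A" "op_bound s B"
proof -
  have s: "0 \<le> s" using assms(1) by (simp add: op_bound_def)
  have "vec_norm2 (A *\<^sub>v x) \<le> s * vec_norm2 x \<and> vec_norm2 (B *\<^sub>v x) \<le> s * vec_norm2 x"
    if x: "x \<in> carrier_vec (dim_col A)" for x
  proof -
    have "(vec_norm2 ((A @\<^sub>r B) *\<^sub>v x))\<^sup>2 \<le> (s * vec_norm2 x)\<^sup>2"
      using assms(1) x by (intro power_mono) (auto simp: op_bound_def)
    then have "(vec_norm2 (A *\<^sub>v x))\<^sup>2 \<le> (s * vec_norm2 x)\<^sup>2" "(vec_norm2 (B *\<^sub>v x))\<^sup>2 \<le> (s * vec_norm2 x)\<^sup>2"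
      unfolding append_rows_mult_vec_norm[OF x assms(2)]
      using zero_le_power2[of "vec_norm2 (A *\<^sub>v x)"] zero_le_power2[of "vec_norm2 (B *\<^sub>v x)"] by linarith+
    then show ?thesis using s by (auto intro!: power2_le_imp_le)
  qed
  then show "op_bound s A" "op_bound s B" using s assms(2) by (auto simp: op_bound_def)
qed

lemma op_bound_isometry:
  assumes "adj A * A = 1\<^sub>m n"
  shows "op_bound 1 A"
proof -
  have "dim_col A = n" using arg_cong[OF assms, of dim_row] by simp
  then show ?thesis using vec_norm2_isometry[OF assms] by (simp add: op_bound_def)
qed

text \<open>The two equations combine to \<open>C^* C v2 = c^2 v2\<close>, so \<open>C\<close>
  stretches the nonzero vector \<open>v2\<close> by exactly the modulus of \<open>c\<close>.\<close>

lemma dilation_eigenvalue_bound: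
  assumes "op_bound s C" and v: "v1 \<in> carrier_vec (dim_row C)" "v2 \<in> carrier_vec (dim_col C)" "v2 \<noteq> 0\<^sub>v (dim_col C)"
    and eq: "C *\<^sub>v v2 = c \<cdot>\<^sub>v v1" "adj C *\<^sub>v v1 = c \<cdot>\<^sub>v v2"
  shows "cmod c \<le> s"
proof -
  have s: "0 \<le> s" "vec_norm2 (C *\<^sub>v v2) \<le> s * vec_norm2 v2" using assms(1) v by (auto simp: op_bound_def)
  have "adj C *\<^sub>v (C *\<^sub>v v2) = c \<cdot>\<^sub>v (c \<cdot>\<^sub>v v2)"
    using v mult_mat_vec[of "adj C" "dim_col C" "dim_row C" v1 c] by (simp add: eq)
  moreover have "complex_of_real ((vec_norm2 (C *\<^sub>v v2))\<^sup>2) = v2 \<bullet>c (adj C *\<^sub>v (C *\<^sub>v v2))"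
    unfolding vec_norm2_cscalar by (rule cscalar_adj) (use v in \<open>auto intro!: carrier_vecI\<close>)
  ultimately have "complex_of_real ((vec_norm2 (C *\<^sub>v v2))\<^sup>2) = v2 \<bullet>c (c \<cdot>\<^sub>v (c \<cdot>\<^sub>v v2))" by simp
  also have "\<dots> = cnj c * (cnj c * (v2 \<bullet>c v2))"
    using v by (simp add: scalar_prod_def conjugate_complex_def sum_distrib_left algebra_simps)
  finally have "complex_of_real ((vec_norm2 (C *\<^sub>v v2))\<^sup>2) = cnj c * (cnj c * complex_of_real ((vec_norm2 v2)\<^sup>2))"
    by (simp only: vec_norm2_cscalar)
  from arg_cong[OF this, of cmod] have "(vec_norm2 (C *\<^sub>v v2))\<^sup>2 = (cmod c * vec_norm2 v2)\<^sup>2"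
    by (simp add: norm_mult power2_eq_square)
  then have "vec_norm2 (C *\<^sub>v v2) = cmod c * vec_norm2 v2"
    by (metis norm_ge_zero power2_eq_imp_eq vec_norm2_nonneg zero_le_mult_iff)
  then have "cmod c * vec_norm2 v2 \<le> s * vec_norm2 v2" using s by simp
  moreover have "0 < vec_norm2 v2"
    using v vec_norm2_eq_0[of v2] vec_norm2_nonneg[of v2] by (auto simp: less_le)
  ultimately show ?thesis by simp
qed

text \<open>A bound on either \<open>C\<close> or its adjoint suffices, because the eigenvalue
  equations treat \<open>v1\<close> and \<open>v2\<close> symmetrically. Later estimates can thus
  move between a block and its adjoint freely.\<close>

lemma dilation_average_of_unitaries:
  assumes C: "C \<in> carrier_mat p q" and op: "op_bound s C \<or> op_bound s (adj C)"
  defines "H \<equiv> four_block_mat (0\<^sub>m p p) C (adj C) (0\<^sub>m q q)"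
  shows "\<exists>W1 W2. unitary_mat (p + q) W1 \<and> unitary_mat (p + q) W2 \<and> H = complex_of_real (s / 2) \<cdot>\<^sub>m (W1 + W2)"
proof (rule hermitian_average_of_unitaries)
  show H: "H \<in> carrier_mat (p + q) (p + q)" using C by (simp add: H_def)
  show "adj H = H" unfolding H_def using C by (subst adj_four_block[of _ p p _ q _ q]) auto
  show s: "0 \<le> s" using op by (auto simp: op_bound_def)
  fix v c assume v: "v \<in> carrier_vec (p + q)" "v \<noteq> 0\<^sub>v (p + q)" and eig: "H *\<^sub>v v = c \<cdot>\<^sub>v v"
  define v1 v2 where "v1 = vec_first v p" and "v2 = vec_last v q"
  have v12: "v1 \<in> carrier_vec p" "v2 \<in> carrier_vec q" "v = v1 @\<^sub>v v2"
    using v by (auto simp: v1_def v2_def)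
  have "H *\<^sub>v v = (C *\<^sub>v v2) @\<^sub>v (adj C *\<^sub>v v1)"
    unfolding H_def v12(3)
    by (subst four_block_mat_mult_vec[of _ p p _ q _ q]) (use C v12 in auto)
  moreover have "c \<cdot>\<^sub>v v = (c \<cdot>\<^sub>v v1) @\<^sub>v (c \<cdot>\<^sub>v v2)" unfolding v12(3) by (intro eq_vecI) auto
  ultimately have "(C *\<^sub>v v2) @\<^sub>v (adj C *\<^sub>v v1) = (c \<cdot>\<^sub>v v1) @\<^sub>v (c \<cdot>\<^sub>v v2)" using eig by simp
  then have eq: "C *\<^sub>v v2 = c \<cdot>\<^sub>v v1" "adj C *\<^sub>v v1 = c \<cdot>\<^sub>v v2"
    using append_vec_eq[of "C *\<^sub>v v2" p "c \<cdot>\<^sub>v v1"] C v12 by (auto intro!: carrier_vecI)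
  have nz: "v1 \<noteq> 0\<^sub>v p \<or> v2 \<noteq> 0\<^sub>v q" using v v12 by auto
  \<comment> \<open>If the component to which the available bound would be applied is zero, the
    other one is a nonzero vector whose multiple by \<open>c\<close> vanishes.\<close>
  have c0: "c = 0" if "w \<noteq> 0\<^sub>v k" "w \<in> carrier_vec k" "0\<^sub>v k = c \<cdot>\<^sub>v w" for w k
  proof (rule ccontr)
    assume "c \<noteq> 0"
    then have "w $ i = 0" if "i < k" for i
      using arg_cong[OF \<open>0\<^sub>v k = c \<cdot>\<^sub>v w\<close>, of "\<lambda>v. v $ i"] that \<open>w \<in> _\<close> by simp
    then show False using \<open>w \<noteq> _\<close> \<open>w \<in> _\<close> by (metis carrier_vecD eq_vecI index_zero_vec)
  qed
  show "cmod c \<le> s"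
  proof (cases "op_bound s C")
    case True
    show ?thesis
    proof (cases "v2 = 0\<^sub>v q")
      case v20: True
      then have "C *\<^sub>v v2 = 0\<^sub>v p" using C by auto
      then show ?thesis using c0[of v1 p] nz v20 eq v12 s by auto
    next
      case False
      then show ?thesis using dilation_eigenvalue_bound[OF True, of v1 v2 c] C v12 eq by auto
    qed
  next
    case False
    then have op': "op_bound s (adj C)" using op by simp
    show ?thesis
    proof (cases "v1 = 0\<^sub>v p")
      case v10: True
      then have "adj C *\<^sub>v v1 = 0\<^sub>v q" using C by (intro eq_vecI) (auto simp: scalar_prod_def)
      then show ?thesis using c0[of v2 q] nz v10 eq v12 s by auto
    next
      case False
      then show ?thesis using dilation_eigenvalue_bound[OF op', of v2 v1 c] C v12 eq by auto
    qed
  qed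
qed

text \<open>Interchanges two blocks of possibly different sizes. Zero padding at the end, the form
  in which the norm axioms mention it, thereby turns into padding at the front.\<close>

lemma unitary_swap: "unitary_mat (p + q) (four_block_mat (0\<^sub>m p q) (1\<^sub>m p) (1\<^sub>m q) (0\<^sub>m q p))"
proof -
  have "four_block_mat (0\<^sub>m p q) (1\<^sub>m p) (1\<^sub>m q) (0\<^sub>m q p) \<in> carrier_mat (p + q) (p + q)"
    by (intro carrier_matI) auto
  moreover have "adj (four_block_mat (0\<^sub>m p q) (1\<^sub>m p) (1\<^sub>m q) (0\<^sub>m q p)) * four_block_mat (0\<^sub>m p q) (1\<^sub>m p) (1\<^sub>m q) (0\<^sub>m q p)
     = 1\<^sub>m (q + p)"
    apply (subst adj_four_block[of _ p q _ p _ q]; (simp; fail)?)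
    apply (subst mult_four_block_mat[of _ q p _ q _ p _ _ q _ p]; (simp; fail)?)
    done
  ultimately show ?thesis by (simp add: unitary_mat_def add.commute)
qed

section \<open>Unitarily invariant norms: zero padding, stacking and multiplication\<close>

context
  fixes N :: "complex mat \<Rightarrow> real"
  assumes N: "ui_norm N"
begin

lemma ui_norm_nonneg: "0 \<le> N A"
  using N by (simp add: ui_norm_def) (meson carrier_matI)

lemma ui_norm_zero: "N (0\<^sub>m m n) = 0"
  using N unfolding ui_norm_def by (metis zero_carrier_mat)

lemma ui_norm_triangle: "dim_row A = dim_row B \<Longrightarrow> dim_col A = dim_col B \<Longrightarrow> N (A + B) \<le> N A + N B"
  using N unfolding ui_norm_def by (metis carrier_matI)

lemma ui_norm_smult: "N (c \<cdot>\<^sub>m A) = cmod c * N A"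
  using N by (simp add: ui_norm_def)

lemma ui_norm_unitary:
  "unitary_mat (dim_row A) U \<Longrightarrow> unitary_mat (dim_col A) V \<Longrightarrow> N (U * A * V) = N A"
  using N unfolding ui_norm_def by (metis carrier_matI)

lemma ui_norm_unitary_left: "unitary_mat (dim_row A) U \<Longrightarrow> N (U * A) = N A"
  using ui_norm_unitary[OF _ unitary_one, of A U] unitary_matD(3)[of "dim_row A" U] by simp

lemma ui_norm_unitary_right: "unitary_mat (dim_col A) V \<Longrightarrow> N (A * V) = N A"
  using ui_norm_unitary[OF unitary_one, of A V] by simp

lemma ui_norm_append_rows_zero: "n = dim_col A \<Longrightarrow> N (A @\<^sub>r 0\<^sub>m k n) = N A"
proof (induction k)
  case 0
  have "A @\<^sub>r 0\<^sub>m 0 n = A" using 0 by (intro eq_matI) auto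
  then show ?case by simp
next
  case (Suc k)
  have "A @\<^sub>r 0\<^sub>m (Suc k) n = (A @\<^sub>r 0\<^sub>m k n) @\<^sub>r 0\<^sub>m 1 n" using Suc.prems by (intro eq_matI) auto
  also have "N \<dots> = N (A @\<^sub>r 0\<^sub>m k n)"
    using N Suc.prems unfolding ui_norm_def by (metis append_rows_dim(2) carrier_matI)
  finally show ?case using Suc by simp
qed

lemma ui_norm_append_cols_zero: "m = dim_row A \<Longrightarrow> N (append_cols A (0\<^sub>m m k)) = N A"
proof (induction k)
  case 0
  have "append_cols A (0\<^sub>m m 0) = A" using 0 by (intro eq_matI) auto
  then show ?case by simp
next
  case (Suc k)
  have "append_cols A (0\<^sub>m m (Suc k)) = append_cols (append_cols A (0\<^sub>m m k)) (0\<^sub>m m 1)"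
    using Suc.prems by (intro eq_matI) auto
  also have "N \<dots> = N (append_cols A (0\<^sub>m m k))"
    using N Suc.prems unfolding ui_norm_def by (metis append_cols_dim(1) carrier_matI)
  finally show ?case using Suc by simp
qed

lemma ui_norm_zero_append_rows:
  assumes "n = dim_col A"
  shows "N (0\<^sub>m k n @\<^sub>r A) = N A"
proof -
  let ?q = "dim_row A"
  let ?J = "four_block_mat (0\<^sub>m k ?q) (1\<^sub>m k) (1\<^sub>m ?q) (0\<^sub>m ?q k)"
  have "?J * (A @\<^sub>r 0\<^sub>m k n) = 0\<^sub>m k n @\<^sub>r A"
    using assms by (subst four_block_mult_rows) auto
  moreover have "N (?J * (A @\<^sub>r 0\<^sub>m k n)) = N (A @\<^sub>r 0\<^sub>m k n)"
    by (rule ui_norm_unitary_left) (use unitary_swap[of k ?q] in \<open>simp add: add.commute\<close>)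
  ultimately show ?thesis using ui_norm_append_rows_zero[OF assms] by simp
qed

lemma ui_norm_zero_append_cols:
  assumes "m = dim_row A"
  shows "N (append_cols (0\<^sub>m m k) A) = N A"
proof -
  let ?q = "dim_col A"
  let ?J = "four_block_mat (0\<^sub>m ?q k) (1\<^sub>m ?q) (1\<^sub>m k) (0\<^sub>m k ?q)"
  have "append_cols A (0\<^sub>m m k) * ?J = append_cols (0\<^sub>m m k) A"
    using assms by (subst mult_four_block_cols) auto
  moreover have "N (append_cols A (0\<^sub>m m k) * ?J) = N (append_cols A (0\<^sub>m m k))"
    by (rule ui_norm_unitary_right) (use unitary_swap[of ?q k] in simp)
  ultimately show ?thesis using ui_norm_append_cols_zero[OF assms] by simp
qed

text \<open>A stack is the sum of its two parts, each padded with zeros to full height.\<close>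

lemma ui_norm_append_rows_le:
  assumes "dim_col A = dim_col B"
  shows "N (A @\<^sub>r B) \<le> N A + N B"
proof -
  have "A @\<^sub>r B = (A @\<^sub>r 0\<^sub>m (dim_row B) (dim_col A)) + (0\<^sub>m (dim_row A) (dim_col B) @\<^sub>r B)"
    using assms by (subst append_rows_add) auto
  also have "N \<dots> \<le> N (A @\<^sub>r 0\<^sub>m (dim_row B) (dim_col A)) + N (0\<^sub>m (dim_row A) (dim_col B) @\<^sub>r B)"
    by (rule ui_norm_triangle) (use assms in auto)
  finally show ?thesis by (simp add: ui_norm_append_rows_zero ui_norm_zero_append_rows)
qed

lemma ui_norm_mult_left:
  assumes op: "op_bound s C \<or> op_bound s (adj C)" and dim: "dim_col C = dim_row B"
  shows "N (C * B) \<le> s * N B"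
proof -
  define p q where "p = dim_row C" and "q = dim_col C"
  have C: "C \<in> carrier_mat p q" by (auto simp: p_def q_def)
  have dims: "dim_row C = p" "dim_col C = q" "dim_row B = q" using dim by (auto simp: p_def q_def)
  have s: "0 \<le> s" using op by (auto simp: op_bound_def)
  let ?H = "four_block_mat (0\<^sub>m p p) C (adj C) (0\<^sub>m q q)" and ?B = "0\<^sub>m p (dim_col B) @\<^sub>r B"
  obtain W1 W2 where W: "unitary_mat (p + q) W1" "unitary_mat (p + q) W2"
    and H: "?H = complex_of_real (s / 2) \<cdot>\<^sub>m (W1 + W2)"
    using dilation_average_of_unitaries[OF C op] by blast
  note D1 = unitary_matD[OF W(1)] and D2 = unitary_matD[OF W(2)]
  have B: "?B \<in> carrier_mat (p + q) (dim_col B)" using dim by (intro carrier_matI) (auto simp: q_def)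
  \<comment> \<open>In the lower block row \<open>adj C\<close> meets the zero part of
    \<open>?B\<close>, and \<open>B\<close> meets the zero block of \<open>?H\<close>. What remains
    is \<open>C * B\<close> above zero rows, which do not affect the norm.\<close>
  have "?H * ?B = (C * B) @\<^sub>r 0\<^sub>m q (dim_col B)"
    using dims by (subst four_block_mult_rows) simp_all
  then have "N (C * B) = N (?H * ?B)" by (simp add: ui_norm_append_rows_zero)
  also have "?H * ?B = complex_of_real (s / 2) \<cdot>\<^sub>m (W1 * ?B + W2 * ?B)"
    unfolding H using D1 D2 B
    by (simp add: mult_smult_assoc_mat[of _ "p + q" "p + q" _ "dim_col B"] add_mult_distrib_mat[of _ "p + q" "p + q"])
  also have "N \<dots> = s / 2 * N (W1 * ?B + W2 * ?B)" using s by (simp add: ui_norm_smult)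
  also have "\<dots> \<le> s / 2 * (N (W1 * ?B) + N (W2 * ?B))"
    using s D1 D2 by (intro mult_left_mono ui_norm_triangle) auto
  also have "\<dots> = s * N ?B"
    using W dim by (simp add: ui_norm_unitary_left q_def)
  also have "\<dots> = s * N B" by (simp add: ui_norm_zero_append_rows)
  finally show ?thesis .
qed

text \<open>The mirror image: padding \<open>B\<close> with zero columns on the right sets it
  against the upper block row of the dilation.\<close>

lemma ui_norm_mult_right:
  assumes op: "op_bound s C \<or> op_bound s (adj C)" and dim: "dim_col B = dim_row C"
  shows "N (B * C) \<le> s * N B"
proof -
  define p q where "p = dim_row C" and "q = dim_col C"
  have C: "C \<in> carrier_mat p q" by (auto simp: p_def q_def)
  have dims: "dim_row C = p" "dim_col C = q" "dim_col B = p" using dim by (auto simp: p_def q_def)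
  have s: "0 \<le> s" using op by (auto simp: op_bound_def)
  let ?H = "four_block_mat (0\<^sub>m p p) C (adj C) (0\<^sub>m q q)" and ?B = "append_cols B (0\<^sub>m (dim_row B) q)"
  obtain W1 W2 where W: "unitary_mat (p + q) W1" "unitary_mat (p + q) W2"
    and H: "?H = complex_of_real (s / 2) \<cdot>\<^sub>m (W1 + W2)"
    using dilation_average_of_unitaries[OF C op] by blast
  note D1 = unitary_matD[OF W(1)] and D2 = unitary_matD[OF W(2)]
  have B: "?B \<in> carrier_mat (dim_row B) (p + q)" using dim by (intro carrier_matI) (auto simp: p_def)
  have "?B * ?H = append_cols (0\<^sub>m (dim_row B) p) (B * C)"
    using dims by (subst mult_four_block_cols) simp_all
  then have "N (B * C) = N (?B * ?H)" by (simp add: ui_norm_zero_append_cols)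
  also have "?B * ?H = complex_of_real (s / 2) \<cdot>\<^sub>m (?B * W1 + ?B * W2)"
    unfolding H using D1 D2 B
    by (simp add: mult_smult_distrib[of _ "dim_row B" "p + q" _ "p + q"] mult_add_distrib_mat[of _ "dim_row B" "p + q"])
  also have "N \<dots> = s / 2 * N (?B * W1 + ?B * W2)" using s by (simp add: ui_norm_smult)
  also have "\<dots> \<le> s / 2 * (N (?B * W1) + N (?B * W2))"
    using s D1 D2 by (intro mult_left_mono ui_norm_triangle) auto
  also have "\<dots> = s * N ?B"
    using W dim by (simp add: ui_norm_unitary_right p_def)
  also have "\<dots> = s * N B" by (simp add: ui_norm_append_cols_zero)
  finally show ?thesis .
qed

end

section \<open>Singular value estimates, canonical angles and row decompositions\<close>

text \<open>\<open>rdiag\<close> numbers its entries from one, \<open>mat_diag\<close> from zero;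
  hence the \<open>Suc\<close>.\<close>

lemma rdiag_mat_diag: "rdiag k d = mat_diag k (\<lambda>i. complex_of_real (d (Suc i)))"
  by (rule eq_matI) (auto simp: rdiag_def mat_diag_def)

lemma rdiag_dim [simp]: "dim_row (rdiag k d) = k" "dim_col (rdiag k d) = k"
  by (simp_all add: rdiag_def)

lemma vec_norm2_mat_diag:
  assumes "x \<in> carrier_vec n"
  shows "(vec_norm2 (mat_diag n (\<lambda>i. complex_of_real (f i)) *\<^sub>v x))\<^sup>2 = (\<Sum>i<n. (f i)\<^sup>2 * (cmod (x $ i))\<^sup>2)"
proof -
  let ?D = "mat_diag n (\<lambda>i. complex_of_real (f i))"
  have "adj ?D * ?D = 1\<^sub>m n * mat_diag n (\<lambda>i. complex_of_real ((f i)\<^sup>2)) * adj (1\<^sub>m n)"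
    by (simp add: adj_diag power2_eq_square)
  from singular_value_norm(1)[OF unitary_one this assms] show ?thesis using assms by simp
qed

lemma op_bound_mat_diag:
  assumes "0 \<le> s" "\<And>i. i < n \<Longrightarrow> \<bar>f i\<bar> \<le> s"
  shows "op_bound s (mat_diag n (\<lambda>i. complex_of_real (f i)))"
  unfolding op_bound_def
proof (intro conjI ballI)
  fix x :: "complex vec" assume "x \<in> carrier_vec (dim_col (mat_diag n (\<lambda>i. complex_of_real (f i))))"
  then have x: "x \<in> carrier_vec n" by simp
  have sq: "(f i)\<^sup>2 \<le> s\<^sup>2" if "i < n" for i
    using power_mono[OF assms(2)[OF that], of 2] by simp
  have "(vec_norm2 (mat_diag n (\<lambda>i. complex_of_real (f i)) *\<^sub>v x))\<^sup>2 \<le> (\<Sum>i<n. s\<^sup>2 * (cmod (x $ i))\<^sup>2)"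
    unfolding vec_norm2_mat_diag[OF x] by (intro sum_mono mult_right_mono sq) auto
  also have "\<dots> = (s * vec_norm2 x)\<^sup>2"
    using x by (simp add: power_mult_distrib vec_norm2_sq sum_distrib_left)
  finally show "vec_norm2 (mat_diag n (\<lambda>i. complex_of_real (f i)) *\<^sub>v x) \<le> s * vec_norm2 x"
    using assms(1) by (simp add: power2_le_iff_abs_le)
qed (rule assms(1))

text \<open>The Gram matrix is diagonal with entries \<open>(d i)^2\<close>, and nonnegativity makes
  their roots the \<open>d i\<close> again. Sorting forgets the order, so the conclusion concerns
  the set, over which \<open>sigma_min\<close> minimizes.\<close>

lemma set_sing_vals_rdiag:
  assumes "\<And>i. 1 \<le> i \<Longrightarrow> i \<le> k \<Longrightarrow> 0 \<le> d i"
  shows "set (sing_vals (rdiag k d)) = d ` {1..k}"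
proof -
  let ?D = "mat_diag k (\<lambda>i. complex_of_real ((d (Suc i))\<^sup>2))"
  have gram: "adj (rdiag k d) * rdiag k d = ?D"
    unfolding rdiag_mat_diag by (simp add: adj_diag power2_eq_square)
  have "char_poly ?D = (\<Prod>a\<leftarrow>diag_mat ?D. [:- a, 1:])"
    by (rule char_poly_upper_triangular[of _ k]) (auto simp: mat_diag_def)
  then have cp: "proots (char_poly ?D) = mset (diag_mat ?D)" by (simp only: proots_prod_linear)
  have diag: "diag_mat ?D = map (\<lambda>i. complex_of_real ((d (Suc i))\<^sup>2)) [0..<k]"
    by (auto simp: diag_mat_def mat_diag_def)
  have "map (\<lambda>z. sqrt (Re z)) (diag_mat ?D) = map (\<lambda>i. d (Suc i)) [0..<k]"
    unfolding diag using assms by simp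
  then have roots: "image_mset (\<lambda>z. sqrt (Re z)) (proots (char_poly ?D)) = mset (map (\<lambda>i. d (Suc i)) [0..<k])"
    unfolding cp by (metis mset_map)
  have "sing_vals (rdiag k d) = rev (sort (map (\<lambda>i. d (Suc i)) [0..<k]))"
    unfolding sing_vals_def gram roots by (simp del: mset_map)
  then have "set (sing_vals (rdiag k d)) = (\<lambda>i. d (Suc i)) ` {0..<k}" by simp
  also have "\<dots> = d ` (Suc ` {0..<k})" by (simp only: image_image)
  also have "Suc ` {0..<k} = {1..k}" by (simp add: image_Suc_atLeastLessThan atLeastLessThanSuc_atLeastAtMost)
  finally show ?thesis .
qed

lemma sigma_min_rdiag:
  "(\<And>i. 1 \<le> i \<Longrightarrow> i \<le> k \<Longrightarrow> 0 \<le> d i) \<Longrightarrow> sigma_min (rdiag k d) = Min (d ` {1..k})"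
  by (simp add: sigma_min_def set_sing_vals_rdiag)

lemma cmod_index_le_vec_norm2: "i < dim_vec v \<Longrightarrow> cmod (v $ i) \<le> vec_norm2 v"
  unfolding vec_norm2_def by (rule real_le_rsqrt) (auto intro: member_le_sum)

lemma vec_norm2_unit_vec:
  assumes "j < n"
  shows "vec_norm2 (unit_vec n j) = 1"
proof -
  have "(\<Sum>i<n. (cmod (unit_vec n j $ i))\<^sup>2) = (\<Sum>i<n. if i = j then 1 else 0)"
    using assms by (intro sum.cong) auto
  then show ?thesis using assms by (simp add: vec_norm2_def)
qed

text \<open>An entry is a coordinate of the image of a unit vector. This bounds the diagonal of
  \<open>Sig2\<close> by its spectral norm.\<close>

lemma cmod_index_le_spec_norm:
  assumes "i < dim_row C" "j < dim_col C"
  shows "cmod (C $$ (i,j)) \<le> spec_norm C"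
proof -
  have "C *\<^sub>v unit_vec (dim_col C) j = col C j"
    using assms by (intro eq_vecI) auto
  moreover have "vec_norm2 (unit_vec (dim_col C) j) = 1"
    using assms by (intro vec_norm2_unit_vec)
  ultimately have "vec_norm2 (col C j) \<le> spec_norm C"
    using op_bound_spec_norm[of C] unfolding op_bound_def by (metis mult.right_neutral unit_vec_carrier)
  then show ?thesis using cmod_index_le_vec_norm2[of i "col C j"] assms by simp
qed

text \<open>A vector in the range of \<^term>\<open>V\<close> that is orthogonal to the first \<^term>\<open>i - 1\<close> right singular
  vectors of \<^term>\<open>A\<close> is stretched by at most the \<^term>\<open>i\<close>-th singular value.\<close>
lemma sing_val_ge_compression:
  assumes A: "A \<in> carrier_mat m n" and V: "V \<in> carrier_mat n k" "adj V * V = 1\<^sub>m k"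
    and L: "L \<in> carrier_mat k m" "op_bound 1 L" and LAV: "L * A * V = rdiag k d"
    and s: "0 \<le> s" "\<And>j. 1 \<le> j \<Longrightarrow> j \<le> k \<Longrightarrow> s \<le> d j"
    and i: "1 \<le> i" "i \<le> k" "k \<le> min m n"
  shows "s \<le> sing_val A i"
proof -
  obtain P \<sigma> where P: "unitary_mat n P" and len: "length \<sigma> = n" and sorted: "sorted_wrt (\<ge>) \<sigma>"
    and nonneg: "\<And>i. i < n \<Longrightarrow> 0 \<le> \<sigma> ! i"
    and dec: "adj A * A = P * mat_diag n (\<lambda>i. complex_of_real ((\<sigma> ! i)\<^sup>2)) * adj P"
    and sv: "sing_vals A = take (min m n) \<sigma>"
    using singular_value_decomposition[OF A] by blast
  note D = unitary_matD[OF P]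
  have "i - 1 < min m n" using i by linarith
  then have sv_i: "sing_val A i = \<sigma> ! (i - 1)" unfolding sing_val_def sv by (rule nth_take)
  define Q where "Q = adj P * V"
  have Q: "Q \<in> carrier_mat n k" using D V by (auto simp: Q_def)
  \<comment> \<open>\<open>B\<close> keeps the first \<open>i - 1\<close> rows of \<open>Q\<close>
    and is filled up with zero rows to a square matrix. Its last row is zero because
    \<open>i \<le> k\<close>, so it kills some nonzero \<open>c\<close>, and the image of
    \<open>c\<close> under \<open>V\<close> is orthogonal to the first \<open>i - 1\<close> columns
    of \<open>P\<close>.\<close>
  define B where "B = mat k k (\<lambda>(r,c). if r < i - 1 then Q $$ (r,c) else 0)"
  have B: "B \<in> carrier_mat k k" by (simp add: B_def)
  have "det B = 0"
  proof -
    have "\<not> (\<exists>C \<in> carrier_mat k k. B * C = 1\<^sub>m k)"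
    proof
      assume "\<exists>C \<in> carrier_mat k k. B * C = 1\<^sub>m k"
      then obtain C where C: "C \<in> carrier_mat k k" "B * C = 1\<^sub>m k" by blast
      have "(B * C) $$ (k - 1, k - 1) = 0"
        using B C(1) i by (auto simp: scalar_prod_def B_def)
      then show False using C(2) i by simp
    qed
    then show ?thesis
      using det_non_zero_imp_unit[OF B, of "()"] by (auto simp: Units_def ring_mat_def)
  qed
  then obtain c where c: "c \<in> carrier_vec k" "c \<noteq> 0\<^sub>v k" "B *\<^sub>v c = 0\<^sub>v k"
    using det_0_iff_vec_prod_zero[OF B] by blast
  define x where "x = V *\<^sub>v c"
  have x: "x \<in> carrier_vec n" using V c by (auto simp: x_def)
  have norm_x: "vec_norm2 x = vec_norm2 c" unfolding x_def by (rule vec_norm2_isometry[OF V(2) c(1)])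
  have Px: "adj P *\<^sub>v x = Q *\<^sub>v c"
    unfolding x_def Q_def using D V c by (intro assoc_mult_mat_vec[symmetric, of _ n n _ k]) auto
  have zero: "(adj P *\<^sub>v x) $ r = 0" if "r < i - 1" for r
  proof -
    have "(Q *\<^sub>v c) $ r = (B *\<^sub>v c) $ r"
      using that i Q c(1) by (auto simp: B_def scalar_prod_def intro!: sum.cong)
    then show ?thesis using that i c by (simp add: Px)
  qed
  have "(vec_norm2 (A *\<^sub>v x))\<^sup>2 = (\<Sum>j<n. (\<sigma> ! j)\<^sup>2 * (cmod ((adj P *\<^sub>v x) $ j))\<^sup>2)"
    by (rule singular_value_norm(1)[OF P dec x])
  also have "\<dots> \<le> (\<Sum>j<n. (\<sigma> ! (i - 1))\<^sup>2 * (cmod ((adj P *\<^sub>v x) $ j))\<^sup>2)"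
  proof (rule sum_mono)
    fix j assume "j \<in> {..<n}"
    then have j: "j < n" by simp
    show "(\<sigma> ! j)\<^sup>2 * (cmod ((adj P *\<^sub>v x) $ j))\<^sup>2 \<le> (\<sigma> ! (i - 1))\<^sup>2 * (cmod ((adj P *\<^sub>v x) $ j))\<^sup>2"
    proof (cases "j < i - 1")
      case True
      then show ?thesis using zero by simp
    next
      case False
      then have "\<sigma> ! j \<le> \<sigma> ! (i - 1)"
        using sorted j len by (cases "j = i - 1") (auto simp: sorted_wrt_iff_nth_less)
      then show ?thesis using nonneg[OF j] by (intro mult_right_mono power_mono) auto
    qed
  qed
  also have "\<dots> = (\<sigma> ! (i - 1) * vec_norm2 c)\<^sup>2"
    using singular_value_norm(2)[OF P dec x] norm_x by (simp add: power_mult_distrib sum_distrib_left)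
  finally have upper: "vec_norm2 (A *\<^sub>v x) \<le> \<sigma> ! (i - 1) * vec_norm2 c"
    using nonneg[of "i - 1"] \<open>i - 1 < min m n\<close> by (intro power2_le_imp_le[of "vec_norm2 (A *\<^sub>v x)"]) simp_all
  have Ax: "A *\<^sub>v x \<in> carrier_vec m" using A x by auto
  \<comment> \<open>The opposite estimate: \<open>L\<close> does not lengthen vectors, so
    \<open>A x\<close> is at least as long as \<open>rdiag k d *\<^sub>v c\<close>, whose length is
    at least \<open>s\<close> times that of \<open>c\<close>.\<close>
  have "rdiag k d *\<^sub>v c = L *\<^sub>v (A *\<^sub>v x)"
  proof -
    have "rdiag k d *\<^sub>v c = (L * A) *\<^sub>v (V *\<^sub>v c)"
      unfolding LAV[symmetric] by (rule assoc_mult_mat_vec[of _ k n _ k]) (use A L V c in auto)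
    also have "\<dots> = L *\<^sub>v (A *\<^sub>v (V *\<^sub>v c))"
      by (rule assoc_mult_mat_vec[of _ k m _ n]) (use A L V c in auto)
    finally show ?thesis by (simp add: x_def)
  qed
  then have "vec_norm2 (rdiag k d *\<^sub>v c) \<le> vec_norm2 (A *\<^sub>v x)"
    using L Ax by (auto simp: op_bound_def)
  moreover have "(s * vec_norm2 c)\<^sup>2 \<le> (vec_norm2 (rdiag k d *\<^sub>v c))\<^sup>2"
    unfolding rdiag_mat_diag vec_norm2_mat_diag[OF c(1)]
    using c(1) s by (auto simp: power_mult_distrib vec_norm2_sq sum_distrib_left intro!: sum_mono mult_right_mono power_mono)
  then have "s * vec_norm2 c \<le> vec_norm2 (rdiag k d *\<^sub>v c)" by (rule power2_le_imp_le) simp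
  ultimately have "s * vec_norm2 c \<le> \<sigma> ! (i - 1) * vec_norm2 c" using upper by linarith
  moreover have "0 < vec_norm2 c"
    using c vec_norm2_eq_0[of c] vec_norm2_nonneg[of c] by (auto simp: less_le)
  ultimately show ?thesis by (simp add: sv_i)
qed

text \<open>A row past the end is the zero row. This realizes the conventions of (iii), where
  \<open>X2\<close> and \<open>Y2\<close> may have different numbers of rows.\<close>

definition row_mat :: "complex mat \<Rightarrow> nat \<Rightarrow> complex mat" where
  "row_mat M i = mat 1 (dim_col M) (\<lambda>(_,j). if i < dim_row M then M $$ (i,j) else 0)"

definition col_mat :: "complex mat \<Rightarrow> nat \<Rightarrow> complex mat" where
  "col_mat M j = mat (dim_row M) 1 (\<lambda>(i,_). M $$ (i,j))"

lemma row_mat_dim [simp]: "dim_row (row_mat M i) = 1" "dim_col (row_mat M i) = dim_col M"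
  by (simp_all add: row_mat_def)

lemma row_mat_mult: "dim_col A = dim_row B \<Longrightarrow> row_mat (A * B) i = row_mat A i * B"
  by (rule eq_matI) (auto simp: row_mat_def scalar_prod_def)

lemma row_mat_add:
  "dim_row A = dim_row B \<Longrightarrow> dim_col A = dim_col B \<Longrightarrow> row_mat (A + B) i = row_mat A i + row_mat B i"
  by (rule eq_matI) (auto simp: row_mat_def)

lemma op_bound_column:
  assumes "dim_col C = 1"
  shows "op_bound (vec_norm2 (col C 0)) C"
  unfolding op_bound_def
proof (intro conjI ballI)
  fix x :: "complex vec" assume x: "x \<in> carrier_vec (dim_col C)"
  then have "C *\<^sub>v x = x $ 0 \<cdot>\<^sub>v col C 0"
    using assms by (intro eq_vecI) (auto simp: scalar_prod_def)
  moreover have "cmod (x $ 0) \<le> vec_norm2 x" by (rule cmod_index_le_vec_norm2) (use x assms in auto)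
  ultimately show "vec_norm2 (C *\<^sub>v x) \<le> vec_norm2 (col C 0) * vec_norm2 x"
    by (simp add: vec_norm2_smult mult.commute[of "vec_norm2 (col C 0)"] mult_right_mono)
qed simp

text \<open>The adjoint of a row is a single column with conjugated entries, so its length is that
  of the row. A bound on the adjoint is one of the two forms that \<open>ui_norm_mult_left\<close>
  accepts.\<close>

lemma op_bound_row_mat:
  "op_bound (if i < dim_row M then vec_norm2 (row M i) else 0) (adj (row_mat M i))"
proof -
  have "vec_norm2 (col (adj (row_mat M i)) 0) = (if i < dim_row M then vec_norm2 (row M i) else 0)"
    by (simp add: vec_norm2_def row_mat_def)
  then show ?thesis using op_bound_column[of "adj (row_mat M i)"] by simp
qed

section \<open>Comparison of norms through the polar decomposition\<close>

context
  fixes N :: "complex mat \<Rightarrow> real"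
  assumes N: "ui_norm N"
begin

text \<open>With the partial isometry \<open>W\<close> of the polar decomposition and the diagonal matrix \<open>T\<close> of the \<open>t\<^sub>i\<close>,
  one has \<open>T = W\<^sup>* Z P\<close> and \<open>Z\<^sup>* = P T W\<^sup>*\<close>.\<close>
lemma polar_bounds:
  assumes P: "unitary_mat n P" and gram: "adj Z * Z = P * mat_diag n (\<lambda>i. complex_of_real ((t i)\<^sup>2)) * adj P"
  shows "N (mat_diag n (\<lambda>i. complex_of_real (t i))) \<le> N Z"
    and "N (adj Z) \<le> N (mat_diag n (\<lambda>i. complex_of_real (t i)))"
proof -
  note D = unitary_matD[OF P]
  have Z: "dim_col Z = n" using arg_cong[OF gram, of dim_row] D by simp
  \<comment> \<open>\<open>?U\<close> is the pseudo-inverse of \<open>?T\<close> and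
    \<open>?p\<close> the projection onto its support, so that \<open>Z\<close> may be rank
    deficient.\<close>
  define u where "u i = (if t i = 0 then 0 else 1 / t i)" for i
  define p :: "nat \<Rightarrow> real" where "p i = (if t i = 0 then 0 else 1)" for i
  let ?T = "mat_diag n (\<lambda>i. complex_of_real (t i))" and ?U = "mat_diag n (\<lambda>i. complex_of_real (u i))"
    and ?p = "mat_diag n (\<lambda>i. complex_of_real (p i))"
  define W where "W = Z * P * ?U"
  have W: "dim_row W = dim_row Z" "dim_col W = n" by (simp_all add: W_def)
  have gram': "adj (Z * P) * (Z * P) = mat_diag n (\<lambda>i. complex_of_real ((t i)\<^sup>2))"
  proof -
    have "adj (Z * P) * (Z * P) = adj P * (adj Z * Z) * P" using D Z by (simp add: adj_mult mat_assoc)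
    also have "\<dots> = mat_diag n (\<lambda>i. complex_of_real ((t i)\<^sup>2))"
      unfolding gram using D by (simp add: mat_assoc mult_cancel_left_inverse[of "adj P" P n])
    finally show ?thesis .
  qed
  have adjW: "adj W = ?U * adj (Z * P)"
    unfolding W_def using D Z by (simp add: adj_mult[of "Z * P"] adj_diag)
  have "adj W * W = ?U * (adj (Z * P) * (Z * P)) * ?U"
    unfolding adjW unfolding W_def using D Z by (simp add: mat_assoc)
  also have "\<dots> = mat_diag n (\<lambda>i. complex_of_real (p i) * complex_of_real (p i))"
    unfolding gram' by simp (intro mat_diag_cong, auto simp: u_def p_def power2_eq_square)
  finally have "adj W * W = adj ?p * ?p" by (simp add: adj_diag)
  then have "op_bound 1 W"
    using vec_norm2_gram_cong[of W ?p] op_bound_mat_diag[of 1 n p] W by (simp add: op_bound_def p_def)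
  then have op: "op_bound 1 (adj W) \<or> op_bound 1 (adj (adj W))" by simp
  have "adj W * (Z * P) = ?U * (adj (Z * P) * (Z * P))"
    unfolding adjW using D Z by (simp add: mat_assoc)
  also have "\<dots> = ?T"
    unfolding gram' by simp (intro mat_diag_cong, auto simp: u_def power2_eq_square)
  finally have "N ?T = N (adj W * (Z * P))" by simp
  also have "\<dots> \<le> 1 * N (Z * P)"
    by (rule ui_norm_mult_left[OF N op]) (use W in simp)
  finally show "N ?T \<le> N Z" using ui_norm_unitary_right[OF N, of Z P] P Z by simp
  have ZP: "Z * P \<in> carrier_mat (dim_row Z) n" using D by (intro carrier_matI) auto
  have "Z * P * ?p = Z * P"
    unfolding mat_diag_mult_right[OF ZP]
  proof (rule eq_matI)
    fix i j assume "i < dim_row (Z * P)" "j < dim_col (Z * P)"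
    then have ij: "i < dim_row Z" "j < n" using D by auto
    show "mat (dim_row Z) n (\<lambda>(i,j). (Z * P) $$ (i,j) * complex_of_real (p j)) $$ (i,j) = (Z * P) $$ (i,j)"
    \<comment> \<open>If \<open>t j\<close> is zero, column \<open>j\<close> of \<open>Z * P\<close>
      has length zero, so masking it by \<open>p\<close> changes nothing.\<close>
    proof (cases "t j = 0")
      case True
      have "complex_of_real ((vec_norm2 (col (Z * P) j))\<^sup>2) = 0"
        using gram_diag_entry[OF gram' ij(2)] True by simp
      then have "col (Z * P) j = 0\<^sub>v (dim_row Z)" using vec_norm2_eq_0[of "col (Z * P) j"] by simp
      from arg_cong[OF this, of "\<lambda>v. v $ i"] have "(Z * P) $$ (i,j) = 0" using ij D by simp
      then show ?thesis using ij by simp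
    qed (use ij in \<open>simp add: p_def\<close>)
  qed (use D in auto)
  then have "adj (Z * P) = adj (Z * P * ?p)" by simp
  also have "\<dots> = ?p * adj (Z * P)" by (subst adj_mult) (simp_all add: D adj_diag)
  also have "?p = ?T * ?U"
    by simp (intro mat_diag_cong, auto simp: p_def u_def)
  also have "?T * ?U * adj (Z * P) = ?T * adj W"
    unfolding adjW by (rule mat_assoc) (simp_all add: D)
  finally have "adj (Z * P) = ?T * adj W" .
  moreover have "adj Z = P * adj (Z * P)"
    using D Z by (simp add: adj_mult mult_cancel_left_inverse[of P "adj P" n])
  ultimately have "N (adj Z) = N (P * (?T * adj W))" by simp
  also have "\<dots> = N (?T * adj W)" using P by (intro ui_norm_unitary_left[OF N]) simp
  also have "\<dots> \<le> 1 * N ?T" by (rule ui_norm_mult_right[OF N op]) (use W in simp)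
  finally show "N (adj Z) \<le> N ?T" by simp
qed

text \<open>Passing through the diagonal matrix of singular values gives one inequality; applied to
  the adjoint it gives the other.\<close>

lemma ui_norm_adj: "N (adj Z) = N Z"
proof -
  have le: "N (adj M) \<le> N M" for M
  proof -
    obtain P \<sigma> where "unitary_mat (dim_col M) P"
      "adj M * M = P * mat_diag (dim_col M) (\<lambda>i. complex_of_real ((\<sigma> ! i)\<^sup>2)) * adj P"
      using singular_value_decomposition[of M "dim_row M" "dim_col M"] by blast
    from polar_bounds[OF this] show ?thesis by linarith
  qed
  show ?thesis using le[of Z] le[of "adj Z"] by simp
qed

text \<open>The Gram matrix of \<open>Z\<close> is the identity minus that of \<open>X\<close>, so
  one \<open>P\<close> diagonalizes both, and cosines \<open>\<sigma> ! i\<close> of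
  \<open>X\<close> become sines \<open>sqrt (1 - (\<sigma> ! i)^2)\<close> of \<open>Z\<close>. In
  the application \<open>Z\<close> is \<open>X2\<close> stacked on \<open>X3\<close>. The adjoint
  appears because the angles are defined from \<open>U1^* U1h\<close>, whereas \<open>X\<close> is
  \<open>U1h^* U1\<close>.\<close>

lemma ui_norm_sin_arccos:
  assumes X: "X \<in> carrier_mat k k" and XZ: "adj X * X + adj Z * Z = 1\<^sub>m k"
  shows "N (rdiag k (\<lambda>i. sin (arccos (sing_val (adj X) i)))) \<le> N Z"
proof -
  obtain P \<sigma> where P: "unitary_mat k P" and len: "length \<sigma> = k"
    and nonneg: "\<And>i. i < k \<Longrightarrow> 0 \<le> \<sigma> ! i"
    and dec: "adj X * X = P * mat_diag k (\<lambda>i. complex_of_real ((\<sigma> ! i)\<^sup>2)) * adj P"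
    and sv: "sing_vals X = take (min k k) \<sigma>"
    using singular_value_decomposition[OF X] by blast
  note D = unitary_matD[OF P]
  have Z: "dim_col Z = k" using arg_cong[OF XZ, of dim_row] by simp
  let ?S = "mat_diag k (\<lambda>i. complex_of_real ((\<sigma> ! i)\<^sup>2))" and ?C = "mat_diag k (\<lambda>i. complex_of_real (1 - (\<sigma> ! i)\<^sup>2))"
  have "?S + ?C = 1\<^sub>m k" by (rule eq_matI) (auto simp: mat_diag_def)
  then have "P * ?S * adj P + P * ?C * adj P = 1\<^sub>m k"
    using D by (simp add: mat_distrib(1)[symmetric] mat_distrib(2)[symmetric] mat_assoc)
  then have sum_eq: "adj X * X + P * ?C * adj P = adj X * X + adj Z * Z" using XZ dec by simp
  have gram: "adj Z * Z = P * ?C * adj P"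
  proof (rule eq_matI)
    fix i j assume "i < dim_row (P * ?C * adj P)" "j < dim_col (P * ?C * adj P)"
    then show "(adj Z * Z) $$ (i,j) = (P * ?C * adj P) $$ (i,j)"
      using arg_cong[OF sum_eq, of "\<lambda>M. M $$ (i,j)"] D Z X by (simp del: index_mult_mat(1))
  qed (use Z D in auto)
  have "adj (Z * P) * (Z * P) = adj P * (adj Z * Z) * P" using D Z by (simp add: adj_mult mat_assoc)
  also have "\<dots> = ?C"
    unfolding gram using D by (simp add: mat_assoc mult_cancel_left_inverse[of "adj P" P k])
  finally have "1 - (\<sigma> ! i)\<^sup>2 = (vec_norm2 (col (Z * P) i))\<^sup>2" if "i < k" for i
    using gram_diag_entry[of "Z * P" k _ i] that by (metis (no_types, lifting) of_real_eq_iff)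
  \<comment> \<open>The difference from 1 is a squared column length. This places the singular
    values in the domain where \<open>arccos\<close> is meaningful.\<close>
  then have le: "(\<sigma> ! i)\<^sup>2 \<le> 1" if "i < k" for i
    using that by (metis diff_ge_0_iff_ge zero_le_power2)
  define t where "t i = sqrt (1 - (\<sigma> ! i)\<^sup>2)" for i
  have "?C = mat_diag k (\<lambda>i. complex_of_real ((t i)\<^sup>2))"
    by (rule mat_diag_cong) (use le in \<open>simp add: t_def\<close>)
  then have "N (mat_diag k (\<lambda>i. complex_of_real (t i))) \<le> N Z"
    using polar_bounds(1)[OF P] gram by simp
  also have "mat_diag k (\<lambda>i. complex_of_real (t i)) = rdiag k (\<lambda>i. sin (arccos (sing_val (adj X) i)))"
    unfolding rdiag_mat_diag
  proof (rule mat_diag_cong)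
    fix i assume i: "i < k"
    have "sing_val (adj X) (Suc i) = \<sigma> ! i"
      using i len by (simp add: sing_val_def sing_vals_adj_square[OF X] sv)
    then show "complex_of_real (t i) = complex_of_real (sin (arccos (sing_val (adj X) (Suc i))))"
      using nonneg[OF i] le[OF i] by (simp add: t_def sin_arccos abs_square_le_1 abs_le_iff)
  qed
  finally show ?thesis by simp
qed

text \<open>\<open>X\<close> is recovered from the product by the inverse diagonal matrix, whose
  entries are at most \<open>1 / s\<close>.\<close>

lemma ui_norm_mult_rdiag_ge:
  assumes "dim_col X = k" "0 < s" "\<And>i. 1 \<le> i \<Longrightarrow> i \<le> k \<Longrightarrow> s \<le> d i"
  shows "s * N X \<le> N (X * rdiag k d)"
proof -
  let ?I = "mat_diag k (\<lambda>i. complex_of_real (1 / d (Suc i)))"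
  have d: "0 < d (Suc i)" "s \<le> d (Suc i)" if "i < k" for i
    using assms(2) assms(3)[of "Suc i"] that by auto
  have "rdiag k d * ?I = mat_diag k (\<lambda>i. 1)"
    unfolding rdiag_mat_diag mat_diag_diag by (rule mat_diag_cong) (auto dest!: d(1))
  then have "X = X * rdiag k d * ?I" using assms(1) by (simp add: mat_assoc)
  moreover have "op_bound (1 / s) ?I"
  proof (rule op_bound_mat_diag)
    show "\<bar>1 / d (Suc i)\<bar> \<le> 1 / s" if "i < k" for i
      using d[OF that] assms(2) by (simp add: frac_le)
  qed (use assms(2) in simp)
  then have "N (X * rdiag k d * ?I) \<le> 1 / s * N (X * rdiag k d)"
    by (intro ui_norm_mult_right[OF N]) auto
  ultimately have "N X \<le> 1 / s * N (X * rdiag k d)" by simp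
  then show ?thesis using assms(2) by (simp add: field_simps)
qed

text \<open>A product is the sum of the outer products of the columns of \<open>C\<close> with the
  rows of \<open>M\<close>; \<open>T k\<close> is the partial sum of the first \<open>k\<close> of
  them.\<close>

lemma ui_norm_mult_rows:
  assumes "dim_col C = dim_row M"
  shows "N (C * M) \<le> (\<Sum>i<dim_row M. vec_norm2 (col C i) * N (row_mat M i))"
proof -
  define T where "T k = mat (dim_row C) (dim_col M) (\<lambda>(r,c). \<Sum>l<k. C $$ (r,l) * M $$ (l,c))" for k
  have "N (T k) \<le> (\<Sum>i<k. vec_norm2 (col C i) * N (row_mat M i))" if "k \<le> dim_row M" for k
    using that
  proof (induction k)
    case 0
    have "T 0 = 0\<^sub>m (dim_row C) (dim_col M)" by (rule eq_matI) (auto simp: T_def)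
    then show ?case by (simp add: ui_norm_zero[OF N])
  next
    case (Suc k)
    have "T (Suc k) = T k + col_mat C k * row_mat M k"
      using Suc.prems by (intro eq_matI) (auto simp: T_def row_mat_def col_mat_def scalar_prod_def)
    then have "N (T (Suc k)) \<le> N (T k) + N (col_mat C k * row_mat M k)"
      by (simp add: ui_norm_triangle[OF N] T_def col_mat_def)
    also have "col (col_mat C k) 0 = col C k"
      by (rule eq_vecI) (use Suc.prems assms in \<open>auto simp: col_mat_def\<close>)
    then have "N (col_mat C k * row_mat M k) \<le> vec_norm2 (col C k) * N (row_mat M k)"
      using op_bound_column[of "col_mat C k"] by (intro ui_norm_mult_left[OF N]) (auto simp: col_mat_def)
    finally show ?case using Suc by simp
  qed
  moreover have "T (dim_row M) = C * M"
    using assms by (intro eq_matI) (auto simp: T_def scalar_prod_def atLeast0LessThan)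
  ultimately show ?thesis by (metis order_refl)
qed

end

section \<open>The block equations and the resulting scalar estimates\<close>

text \<open>Multiply \<open>A V1 = U1 D\<close> by \<open>Uh^*\<close> from the left, insert
  \<open>Vh Vh^* = 1\<close> before \<open>V1\<close>, and read off the second and third block rows.
  All sizes are free, so the same lemma serves the adjoint of \<open>A\<close>, with the two sides
  and the roles of \<open>R\<close> and \<open>S\<close> exchanged.\<close>

lemma block_equations:
  assumes A: "A \<in> carrier_mat m n"
    and U: "U1h \<in> carrier_mat m k" "U2h \<in> carrier_mat m p" "U3h \<in> carrier_mat m p'"
    and V: "V1h \<in> carrier_mat n k" "V2h \<in> carrier_mat n q" "V3h \<in> carrier_mat n q'"
    and UU: "unitary_mat m (append_cols U1h (append_cols U2h U3h))"
    and VV: "unitary_mat n (append_cols V1h (append_cols V2h V3h))"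
    and blk: "Sig1 \<in> carrier_mat k k" "Sig2 \<in> carrier_mat p q" "R1 \<in> carrier_mat k q'" "R2 \<in> carrier_mat p q'"
      "S1 \<in> carrier_mat p' k" "S2 \<in> carrier_mat p' q" "A3 \<in> carrier_mat p' q'"
    and dec: "adj (append_cols U1h (append_cols U2h U3h)) * A * append_cols V1h (append_cols V2h V3h)
       = four_block_mat (four_block_mat Sig1 (0\<^sub>m k q) (0\<^sub>m p k) Sig2) (R1 @\<^sub>r R2) (append_cols S1 S2) A3"
    and U1: "U1 \<in> carrier_mat m l" and V1: "V1 \<in> carrier_mat n l" and D: "D \<in> carrier_mat l l"
    and AV: "A * V1 = U1 * D"
  shows "Sig2 * (adj V2h * V1) + R2 * (adj V3h * V1) = adj U2h * U1 * D"
    and "S1 * (adj V1h * V1) + S2 * (adj V2h * V1) + A3 * (adj V3h * V1) = adj U3h * U1 * D"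
proof -
  define Uh Vh where "Uh = append_cols U1h (append_cols U2h U3h)" and "Vh = append_cols V1h (append_cols V2h V3h)"
  define X1 X2 X3 Y1 Y2 Y3 where XY: "X1 = adj U1h * U1" "X2 = adj U2h * U1" "X3 = adj U3h * U1"
    "Y1 = adj V1h * V1" "Y2 = adj V2h * V1" "Y3 = adj V3h * V1"
  define Sig where "Sig = four_block_mat Sig1 (0\<^sub>m k q) (0\<^sub>m p k) Sig2"
  let ?M = "four_block_mat Sig (R1 @\<^sub>r R2) (append_cols S1 S2) A3"
  note U = unitary_matD[OF UU, folded Uh_def] U and V = unitary_matD[OF VV, folded Vh_def] V
  note dims = A[THEN carrier_matD(1)] A[THEN carrier_matD(2)] U(2,3) V(2,3)
    U(6-8)[THEN carrier_matD(1)] U(6-8)[THEN carrier_matD(2)] V(6-8)[THEN carrier_matD(1)] V(6-8)[THEN carrier_matD(2)]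
    blk[THEN carrier_matD(1)] blk[THEN carrier_matD(2)]
    U1[THEN carrier_matD(1)] U1[THEN carrier_matD(2)] V1[THEN carrier_matD(1)] V1[THEN carrier_matD(2)]
    D[THEN carrier_matD(1)] D[THEN carrier_matD(2)]
  have XYdims: "dim_row X1 = k" "dim_row X2 = p" "dim_row X3 = p'" "dim_row Y1 = k" "dim_row Y2 = q" "dim_row Y3 = q'"
    "dim_col X1 = l" "dim_col X2 = l" "dim_col X3 = l" "dim_col Y1 = l" "dim_col Y2 = l" "dim_col Y3 = l"
    by (simp_all add: XY dims)
  have Sig: "dim_row Sig = k + p" "dim_col Sig = k + q" by (simp_all add: Sig_def dims)
  have X: "adj Uh * U1 = (X1 @\<^sub>r X2) @\<^sub>r X3"
    unfolding Uh_def XY by (simp add: append_cols_adj append_rows_mult append_rows_assoc dims)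
  have Y: "adj Vh * V1 = (Y1 @\<^sub>r Y2) @\<^sub>r Y3"
    unfolding Vh_def XY by (simp add: append_cols_adj append_rows_mult append_rows_assoc dims)
  have "?M * (adj Vh * V1) = adj Uh * (A * (Vh * (adj Vh * V1)))"
    unfolding dec[folded Uh_def Vh_def Sig_def, symmetric] by (simp add: mat_assoc dims)
  also have "Vh * (adj Vh * V1) = V1" by (rule mult_cancel_left_inverse[OF V(5)]) (simp_all add: dims)
  also have "adj Uh * (A * V1) = adj Uh * U1 * D" unfolding AV by (simp add: mat_assoc dims)
  finally have "?M * ((Y1 @\<^sub>r Y2) @\<^sub>r Y3) = ((X1 @\<^sub>r X2) @\<^sub>r X3) * D" unfolding X Y .
  also have "((X1 @\<^sub>r X2) @\<^sub>r X3) * D = ((X1 * D) @\<^sub>r (X2 * D)) @\<^sub>r (X3 * D)"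
    by (simp add: append_rows_mult XYdims dims)
  also have "?M * ((Y1 @\<^sub>r Y2) @\<^sub>r Y3)
      = (Sig * (Y1 @\<^sub>r Y2) + (R1 @\<^sub>r R2) * Y3) @\<^sub>r (append_cols S1 S2 * (Y1 @\<^sub>r Y2) + A3 * Y3)"
    by (rule four_block_mult_rows) (simp_all add: XYdims dims Sig)
  also have "append_cols S1 S2 * (Y1 @\<^sub>r Y2) = S1 * Y1 + S2 * Y2"
    by (rule append_cols_mult_rows) (simp_all add: XYdims dims)
  also have "Sig * (Y1 @\<^sub>r Y2) = (Sig1 * Y1) @\<^sub>r (Sig2 * Y2)"
    unfolding Sig_def by (subst four_block_mult_rows) (simp_all add: XYdims dims)
  also have "((Sig1 * Y1) @\<^sub>r (Sig2 * Y2)) + (R1 @\<^sub>r R2) * Y3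
      = (Sig1 * Y1 + R1 * Y3) @\<^sub>r (Sig2 * Y2 + R2 * Y3)"
    by (simp add: append_rows_mult append_rows_add XYdims dims)
  finally have eq: "((Sig1 * Y1 + R1 * Y3) @\<^sub>r (Sig2 * Y2 + R2 * Y3)) @\<^sub>r (S1 * Y1 + S2 * Y2 + A3 * Y3)
     = ((X1 * D) @\<^sub>r (X2 * D)) @\<^sub>r (X3 * D)" .
  have top: "(Sig1 * Y1 + R1 * Y3) @\<^sub>r (Sig2 * Y2 + R2 * Y3) = (X1 * D) @\<^sub>r (X2 * D)"
    by (rule append_rows_inject(1)[OF eq]) (simp_all add: XYdims dims)
  show "Sig2 * (adj V2h * V1) + R2 * (adj V3h * V1) = adj U2h * U1 * D"
    unfolding XY[symmetric] by (rule append_rows_inject(2)[OF top]) (simp_all add: XYdims dims)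
  show "S1 * (adj V1h * V1) + S2 * (adj V2h * V1) + A3 * (adj V3h * V1) = adj U3h * U1 * D"
    unfolding XY[symmetric] by (rule append_rows_inject(2)[OF eq]) (simp_all add: XYdims dims)
qed

text \<open>Collects what follows from \<open>Uh\<close> being unitary and \<open>Uh^* U1\<close> an
  isometry; the \<open>V\<close> side is another instance. The contraction \<open>X1\<close> serves
  (ii) and (iii), the stacked one serves (i), and the last two facts make the leading block a
  compression of \<open>A\<close>.\<close>

lemma block_isometry:
  assumes N: "ui_norm N"
    and U: "U1h \<in> carrier_mat m k" "U2h \<in> carrier_mat m p" "U3h \<in> carrier_mat m p'"
    and UU: "unitary_mat m (append_cols U1h (append_cols U2h U3h))"
    and U1: "U1 \<in> carrier_mat m k" "orthonormal_cols U1"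
  shows "op_bound 1 (adj U1h * U1)" "op_bound 1 ((adj U1h * U1) @\<^sub>r (adj U2h * U1))"
    "N (sin_angle U1 U1h) \<le> N (adj U2h * U1) + N (adj U3h * U1)"
    "op_bound 1 (adj U1h)" "adj U1h * U1h = 1\<^sub>m k"
proof -
  define Uh where "Uh = append_cols U1h (append_cols U2h U3h)"
  note UhD = unitary_matD[OF UU, folded Uh_def]
  note dims = UhD(2,3) U[THEN carrier_matD(1)] U[THEN carrier_matD(2)] U1(1)[THEN carrier_matD(1)] U1(1)[THEN carrier_matD(2)]
  let ?X1 = "adj U1h * U1" and ?X2 = "adj U2h * U1" and ?X3 = "adj U3h * U1"
  have adjUh: "adj Uh = adj U1h @\<^sub>r (adj U2h @\<^sub>r adj U3h)"
    unfolding Uh_def by (simp add: append_cols_adj dims)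
  then have X: "adj Uh * U1 = ?X1 @\<^sub>r (?X2 @\<^sub>r ?X3)" by (simp add: append_rows_mult dims)
  have gram: "adj (adj Uh * U1) * (adj Uh * U1) = 1\<^sub>m k"
    using U1(2) by (simp add: adj_mult mat_assoc dims mult_cancel_left_inverse[OF UhD(5)] orthonormal_cols_def)
  note X_bound = op_bound_isometry[OF gram, unfolded X]
  show "op_bound 1 ?X1" by (rule op_bound_append_rowsD(1)[OF X_bound]) simp
  have "op_bound 1 ((?X1 @\<^sub>r ?X2) @\<^sub>r ?X3)" using X_bound by (simp add: append_rows_assoc)
  then show "op_bound 1 (?X1 @\<^sub>r ?X2)" by (rule op_bound_append_rowsD(1)) simp
  have "adj ?X1 * ?X1 + adj (?X2 @\<^sub>r ?X3) * (?X2 @\<^sub>r ?X3) = 1\<^sub>m k"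
    using gram unfolding X by (simp add: append_rows_gram)
  then have "N (rdiag k (\<lambda>i. sin (arccos (sing_val (adj ?X1) i)))) \<le> N (?X2 @\<^sub>r ?X3)"
    by (intro ui_norm_sin_arccos[OF N] carrier_matI) (simp_all add: dims)
  moreover have "sin_angle U1 U1h = rdiag k (\<lambda>i. sin (arccos (sing_val (adj ?X1) i)))"
    by (simp add: sin_angle_def adj_mult dims)
  ultimately show "N (sin_angle U1 U1h) \<le> N ?X2 + N ?X3"
    using ui_norm_append_rows_le[OF N, of ?X2 ?X3] by simp
  have "op_bound 1 (adj Uh)" by (rule op_bound_isometry[of _ m]) (use UhD in simp)
  then show "op_bound 1 (adj U1h)" unfolding adjUh by (rule op_bound_append_rowsD(1)) (simp add: dims)
  show "adj U1h * U1h = 1\<^sub>m k"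
  proof (rule eq_matI)
    fix i j assume ij: "i < dim_row (1\<^sub>m k :: complex mat)" "j < dim_col (1\<^sub>m k :: complex mat)"
    \<comment> \<open>\<open>U1h\<close> forms the first \<open>k\<close> columns of
      \<open>Uh\<close>, so its Gram matrix is the leading block of the identity.\<close>
    have "(adj U1h * U1h) $$ (i,j) = (adj Uh * Uh) $$ (i,j)"
      using ij by (auto simp: Uh_def dims scalar_prod_def intro!: sum.cong)
    also have "\<dots> = 1\<^sub>m k $$ (i,j)"
    proof -
      have "k \<le> m" using UhD(3) by (simp add: Uh_def dims)
      then show ?thesis unfolding UhD(4) using ij by simp
    qed
    finally show "(adj U1h * U1h) $$ (i,j) = 1\<^sub>m k $$ (i,j)" .
  qed (simp_all add: dims)
qed

section \<open>Row-by-row estimates against a rectangular diagonal block\<close>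

lemma rect_diag_dim [simp]: "dim_row (rect_diag p q f) = p" "dim_col (rect_diag p q f) = q"
  by (simp_all add: rect_diag_def)

lemma adj_rect_diag: "adj (rect_diag p q f) = rect_diag q p f"
  by (rule eq_matI) (auto simp: rect_diag_def)

text \<open>For \<open>i \<ge> p\<close> the left row is zero by the default of
  \<open>row_mat\<close>, and for \<open>q \<le> i < p\<close> it contains no diagonal position; the
  coefficient 0 covers both cases.\<close>

lemma row_mat_rect_diag_mult:
  assumes "dim_row B = q"
  shows "row_mat (rect_diag p q f) i * B
    = complex_of_real (if i < min p q then f (Suc i) else 0) \<cdot>\<^sub>m row_mat B i"
proof (rule eq_matI)
  fix a j assume "a < dim_row (complex_of_real (if i < min p q then f (Suc i) else 0) \<cdot>\<^sub>m row_mat B i)"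
    and j: "j < dim_col (complex_of_real (if i < min p q then f (Suc i) else 0) \<cdot>\<^sub>m row_mat B i)"
  then have a: "a = 0" by simp
  have "(row_mat (rect_diag p q f) i * B) $$ (a,j) = (\<Sum>l\<in>{0..<q}. row_mat (rect_diag p q f) i $$ (a,l) * B $$ (l,j))"
    using a j assms by (simp add: scalar_prod_def)
  also have "\<dots> = (\<Sum>l\<in>{0..<q}. if l = i then (if i < p then complex_of_real (f (Suc i)) * B $$ (i,j) else 0) else 0)"
    using a by (intro sum.cong refl) (auto simp: row_mat_def rect_diag_def)
  also have "\<dots> = (if i < min p q then complex_of_real (f (Suc i)) * B $$ (i,j) else 0)" by simp
  finally have entry: "(row_mat (rect_diag p q f) i * B) $$ (a,j)
      = (if i < min p q then complex_of_real (f (Suc i)) * B $$ (i,j) else 0)" .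
  show "(row_mat (rect_diag p q f) i * B) $$ (a,j)
      = (complex_of_real (if i < min p q then f (Suc i) else 0) \<cdot>\<^sub>m row_mat B i) $$ (a,j)"
    unfolding entry using a j assms by (auto simp: row_mat_def)
qed (use assms in auto)

context
  fixes N :: "complex mat \<Rightarrow> real"
  assumes N: "ui_norm N"
begin

lemma ui_norm_two_term_bound:
  assumes eq: "C * Y + E * Z = X * rdiag k d"
    and dims: "dim_col X = k" "dim_col Y = k" "dim_col Z = k" "dim_row C = dim_row E" "dim_col C = dim_row Y" "dim_col E = dim_row Z"
    and s: "0 < s" "\<And>i. 1 \<le> i \<Longrightarrow> i \<le> k \<Longrightarrow> s \<le> d i"
  shows "s * N X \<le> N (C * Y) + N (E * Z)"
proof -
  have "s * N X \<le> N (X * rdiag k d)" by (rule ui_norm_mult_rdiag_ge[OF N]) (use dims s in auto)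
  also have "\<dots> \<le> N (C * Y) + N (E * Z)"
    unfolding eq[symmetric] by (rule ui_norm_triangle[OF N]) (use dims in auto)
  finally show ?thesis .
qed

text \<open>Taking a row commutes with multiplication from the right, and a diagonal left factor
  couples row \<open>i\<close> of \<open>X\<close> to row \<open>i\<close> of \<open>Y\<close>
  alone. The estimate of the whole block has a spectral norm where a single diagonal entry stands
  here.\<close>

lemma ui_norm_row_bound:
  assumes eq: "rect_diag p q f * Y + E * Z = X * rdiag k d"
    and dims: "dim_col X = k" "dim_col Y = k" "dim_col Z = k" "dim_row E = p" "dim_row X = p" "dim_row Y = q" "dim_col E = dim_row Z"
    and s: "0 < s" "\<And>i. 1 \<le> i \<Longrightarrow> i \<le> k \<Longrightarrow> s \<le> d i" and f: "\<And>i. 0 \<le> f i"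
  shows "s * N (row_mat X i) \<le> (if i < min p q then f (Suc i) else 0) * N (row_mat Y i)
    + (if i < p then vec_norm2 (row E i) else 0) * N Z"
proof -
  have "row_mat (rect_diag p q f) i * Y + row_mat E i * Z = row_mat X i * rdiag k d"
    using arg_cong[OF eq, of "\<lambda>M. row_mat M i"] dims by (simp add: row_mat_add row_mat_mult)
  then have "s * N (row_mat X i) \<le> N (row_mat (rect_diag p q f) i * Y) + N (row_mat E i * Z)"
    by (rule ui_norm_two_term_bound) (use dims s in auto)
  also have "N (row_mat (rect_diag p q f) i * Y) = (if i < min p q then f (Suc i) else 0) * N (row_mat Y i)"
    using f by (simp add: row_mat_rect_diag_mult[OF dims(6)] ui_norm_smult[OF N] del: of_real_0)
  also have "N (row_mat E i * Z) \<le> (if i < p then vec_norm2 (row E i) else 0) * N Z"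
    using op_bound_row_mat[of i E] dims by (intro ui_norm_mult_left[OF N]) auto
  finally show ?thesis by simp
qed

text \<open>Write \<open>M\<close> as the identity times \<open>M\<close>; the columns of the
  identity have length one.\<close>

lemma ui_norm_le_sum_rows: "N M \<le> (\<Sum>i<dim_row M. N (row_mat M i))"
proof -
  have "vec_norm2 (col (1\<^sub>m (dim_row M)) i) = 1" if "i < dim_row M" for i
    using that by (simp add: vec_norm2_unit_vec)
  then show ?thesis using ui_norm_mult_rows[OF N, of "1\<^sub>m (dim_row M)" M] by simp
qed

end

section \<open>Scalar inequalities that close the coupled estimates\<close>

lemma sum_lessThan_le_shift:
  fixes f g :: "nat \<Rightarrow> real"
  assumes "p \<le> k" "\<And>i. i < p \<Longrightarrow> f i \<le> g (Suc i)" "\<And>i. 0 \<le> g i"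
  shows "sum f {..<p} \<le> sum g {1..k}"
proof -
  have "sum f {..<p} \<le> (\<Sum>i<p. g (Suc i))" by (intro sum_mono assms) auto
  also have "\<dots> \<le> (\<Sum>i<k. g (Suc i))" using assms by (intro sum_mono2) auto
  also have "\<dots> = sum g {1..k}" by (simp add: sum.atLeast1_atMost_eq)
  finally show ?thesis .
qed

lemma mult_max_le: "s * x \<le> k \<Longrightarrow> s * y \<le> k \<Longrightarrow> s * max x y \<le> (k :: real)"
  by (simp add: max_def)

text \<open>Since \<open>x\<close> and \<open>y\<close> bound each other with the same coefficient
  \<open>h\<close>, both inequalities hold with the maximum \<open>z\<close> on either side:
  \<open>s * z\<close> is at most \<open>h * z\<close> plus the forcing term. Solving for
  \<open>z\<close> uses \<open>h < s\<close>.\<close>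

lemma max_le_of_coupled_bounds:
  fixes s :: real
  assumes "s * x \<le> h * y + r * y'" "s * y \<le> h * x + q * x'" "h < s"
    and "0 \<le> h" "0 \<le> r" "0 \<le> q" "0 \<le> x'" "0 \<le> y'"
  shows "max x y \<le> max r q / (s - h) * max x' y'"
proof -
  have "r * y' \<le> max r q * max x' y'" "q * x' \<le> max r q * max x' y'"
    using assms by (auto intro!: mult_mono)
  moreover have "h * y \<le> h * max x y" "h * x \<le> h * max x y"
    using assms by (auto intro!: mult_left_mono)
  ultimately have "s * x \<le> h * max x y + max r q * max x' y'" "s * y \<le> h * max x y + max r q * max x' y'"
    using assms(1,2) by linarith+
  then have "s * max x y \<le> h * max x y + max r q * max x' y'" by (rule mult_max_le)
  then have "max x y * (s - h) \<le> max r q * max x' y'" by (simp add: algebra_simps)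
  moreover have "0 < s - h" using assms(3) by simp
  ultimately have "max x y \<le> max r q * max x' y' / (s - h)" by (metis pos_le_divide_eq)
  then show ?thesis by (simp only: times_divide_eq_left)
qed

text \<open>Common core of (ii) and (iii): \<open>I\<close> is a singleton when the second blocks
  are estimated as a whole, and \<open>{1..k'}\<close> when they are estimated by rows. The pairs
  \<open>x i\<close>, \<open>y i\<close> measure the second blocks, \<open>x'\<close> and
  \<open>y'\<close> the third ones, \<open>c\<close> is the spectral norm of \<open>A3\<close>, and
  \<open>g\<close> stands for \<open>Gap\<close>, which is at most \<open>s - c\<close>.\<close>

lemma angle_bound_of_coupled_bounds:
  fixes s :: real and x y h r q :: "'i \<Rightarrow> real"
  assumes fin: "finite I"
    and pair: "\<And>i. i \<in> I \<Longrightarrow> s * x i \<le> h i * y i + r i * y'" "\<And>i. i \<in> I \<Longrightarrow> s * y i \<le> h i * x i + q i * x'"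
    and h: "\<And>i. i \<in> I \<Longrightarrow> 0 \<le> h i" "\<And>i. i \<in> I \<Longrightarrow> h i < s"
    and nonneg: "\<And>i. i \<in> I \<Longrightarrow> 0 \<le> r i" "\<And>i. i \<in> I \<Longrightarrow> 0 \<le> q i" "0 \<le> x'" "0 \<le> y'" "0 \<le> c"
    and last: "s * x' \<le> a + (\<Sum>i\<in>I. q i * y i) + c * y'" "s * y' \<le> b + (\<Sum>i\<in>I. r i * x i) + c * x'"
    and g: "g \<le> s - c" "(\<Sum>i\<in>I. (max (r i) (q i))\<^sup>2 / (s - h i)) < g"
    and \<theta>: "\<theta> \<le> (\<Sum>i\<in>I. max (x i) (y i)) + max x' y'"
  shows "\<theta> \<le> max a b / (g - (\<Sum>i\<in>I. (max (r i) (q i))\<^sup>2 / (s - h i))) * (1 + (\<Sum>i\<in>I. max (r i) (q i) / (s - h i)))"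
proof -
  define t where "t = max x' y'"
  define C where "C = (\<Sum>i\<in>I. (max (r i) (q i))\<^sup>2 / (s - h i))"
  define E where "E = (\<Sum>i\<in>I. max (r i) (q i) / (s - h i))"
  have t: "0 \<le> t" "x' \<le> t" "y' \<le> t" using nonneg by (auto simp: t_def)
  have xy: "max (x i) (y i) \<le> max (r i) (q i) / (s - h i) * t" if "i \<in> I" for i
    unfolding t_def by (rule max_le_of_coupled_bounds) (use that pair h nonneg in auto)
  \<comment> \<open>One coupling factor comes from the third block row, the other from the bound
    \<open>xy\<close> on the second blocks; together they form the square.\<close>
  have "q i * y i \<le> (max (r i) (q i))\<^sup>2 / (s - h i) * t \<and> r i * x i \<le> (max (r i) (q i))\<^sup>2 / (s - h i) * t" if i: "i \<in> I" for i
  proof -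
    have "0 \<le> max (r i) (q i) / (s - h i) * t" using h(2)[OF i] nonneg(1)[OF i] t by (simp add: le_max_iff_disj)
    then have *: "z * w \<le> max (r i) (q i) * (max (r i) (q i) / (s - h i) * t)"
      if "0 \<le> z" "z \<le> max (r i) (q i)" "w \<le> max (x i) (y i)" for z w
      using that xy[OF i] nonneg(1)[OF i] order_trans[OF mult_left_mono[of w "max (r i) (q i) / (s - h i) * t" z] mult_right_mono[of z "max (r i) (q i)"]]
      by linarith
    show ?thesis using *[of "q i" "y i"] *[of "r i" "x i"] nonneg(1,2)[OF i]
      by (simp add: power2_eq_square)
  qed
  then have sums: "(\<Sum>i\<in>I. q i * y i) \<le> C * t" "(\<Sum>i\<in>I. r i * x i) \<le> C * t"
    unfolding C_def sum_distrib_right by (auto intro!: sum_mono)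
  have "c * y' \<le> c * t" "c * x' \<le> c * t" using t nonneg(5) by (auto intro: mult_left_mono)
  then have "s * x' \<le> max a b + C * t + c * t" "s * y' \<le> max a b + C * t + c * t"
    using last sums by linarith+
  then have "s * t \<le> max a b + C * t + c * t" unfolding t_def by (rule mult_max_le)
  moreover have "g * t \<le> (s - c) * t" using g(1) t(1) by (rule mult_right_mono)
  ultimately have "t * (g - C) \<le> max a b" by (simp add: algebra_simps)
  then have t_le: "t \<le> max a b / (g - C)" using g(2) by (simp add: C_def pos_le_divide_eq)
  have "E \<ge> 0" unfolding E_def using h(2) nonneg(1) by (intro sum_nonneg divide_nonneg_pos) (auto simp: le_max_iff_disj)
  have "(\<Sum>i\<in>I. max (x i) (y i)) \<le> E * t" unfolding E_def sum_distrib_right by (intro sum_mono xy)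
  then have "\<theta> \<le> t * (1 + E)" using \<theta> by (simp add: t_def algebra_simps)
  also have "\<dots> \<le> max a b / (g - C) * (1 + E)" using t_le \<open>E \<ge> 0\<close> by (intro mult_right_mono) auto
  finally show ?thesis by (simp add: C_def E_def)
qed

theorem theorem6p1:
  fixes A :: "complex mat" and m n k1 km kn :: nat
    and U1h U2h U3h V1h V2h V3h Sig1 Sig2 R1 R2 S1 S2 A3 U1 V1 :: "complex mat"
    and sh :: "nat \<Rightarrow> real"
    and N :: "complex mat \<Rightarrow> real"
  assumes A: "A \<in> carrier_mat m n" and mn: "n \<le> m"
    and k1: "1 \<le> k1" "k1 < min km kn" and kmkn: "km \<le> m" "kn \<le> n"
    and Uh_dims: "U1h \<in> carrier_mat m k1" "U2h \<in> carrier_mat m (km - k1)" "U3h \<in> carrier_mat m (m - km)"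
    and Vh_dims: "V1h \<in> carrier_mat n k1" "V2h \<in> carrier_mat n (kn - k1)" "V3h \<in> carrier_mat n (n - kn)"
    and Uh_unitary: "unitary_mat m (append_cols U1h (append_cols U2h U3h))"
    and Vh_unitary: "unitary_mat n (append_cols V1h (append_cols V2h V3h))"
    and blk_dims: "Sig1 \<in> carrier_mat k1 k1" "Sig2 \<in> carrier_mat (km - k1) (kn - k1)"
      "R1 \<in> carrier_mat k1 (n - kn)" "R2 \<in> carrier_mat (km - k1) (n - kn)"
      "S1 \<in> carrier_mat (m - km) k1" "S2 \<in> carrier_mat (m - km) (kn - k1)"
      "A3 \<in> carrier_mat (m - km) (n - kn)"
    and decomp: "mat_adjoint (append_cols U1h (append_cols U2h U3h)) * A * append_cols V1h (append_cols V2h V3h)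
       = four_block_mat
           (four_block_mat Sig1 (0\<^sub>m k1 (kn - k1)) (0\<^sub>m (km - k1) k1) Sig2)
           (R1 @\<^sub>r R2)
           (append_cols S1 S2)
           A3"
    and sh_nonneg: "\<And>i. 0 \<le> sh i"
    and sig_diag: "four_block_mat Sig1 (0\<^sub>m k1 (kn - k1)) (0\<^sub>m (km - k1) k1) Sig2 = rect_diag km kn sh"
    and U1: "U1 \<in> carrier_mat m k1" "orthonormal_cols U1"
    and V1: "V1 \<in> carrier_mat n k1" "orthonormal_cols V1"
    and triplet1: "A * V1 = U1 * rdiag k1 (sing_val A)"
    and triplet2: "mat_adjoint U1 * A = rdiag k1 (sing_val A) * mat_adjoint V1"
    and N: "ui_norm N"
  defines "Gap \<equiv> sigma_min Sig1 - spec_norm A3"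
    and "gap \<equiv> sigma_min (rdiag k1 (sing_val A)) - spec_norm Sig2"
    and "Theta \<equiv> max (N (sin_angle U1 U1h)) (N (sin_angle V1 V1h))"
    and "R \<equiv> R1 @\<^sub>r R2"
    and "S \<equiv> append_cols S1 S2"
    and "kp \<equiv> max (km - k1) (kn - k1)"
    and "r2 \<equiv> \<lambda>i. if i \<le> km - k1 then vec_norm2 (row R2 (i - 1)) else 0"
    and "s2 \<equiv> \<lambda>i. if i \<le> kn - k1 then vec_norm2 (col S2 (i - 1)) else 0"
    and "shat \<equiv> \<lambda>j. if j \<le> min km kn then sh j else 0"
  assumes Gap_pos: "Gap > 0" and gap_pos: "gap > 0"
  shows "(Theta \<le> max (N R) (N S) / Gap * (1 + max (spec_norm R2) (spec_norm S2) / gap)) \<and>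
         (Gap > (max (spec_norm S2) (spec_norm R2))\<^sup>2 / gap \<longrightarrow>
         Theta \<le> max (N S1) (N R1) / (Gap - (max (spec_norm S2) (spec_norm R2))\<^sup>2 / gap)
                  * (1 + max (spec_norm R2) (spec_norm S2) / gap)) \<and>
         (Gap > (\<Sum>i=1..kp. (max (r2 i) (s2 i))\<^sup>2 / (sigma_min (rdiag k1 (sing_val A)) - shat (k1 + i))) \<longrightarrow>
         Theta \<le> max (N S1) (N R1)
                  / (Gap - (\<Sum>i=1..kp. (max (r2 i) (s2 i))\<^sup>2 / (sigma_min (rdiag k1 (sing_val A)) - shat (k1 + i))))
                  * (1 + (\<Sum>i=1..kp. max (r2 i) (s2 i) / (sigma_min (rdiag k1 (sing_val A)) - shat (k1 + i)))))"
proof -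
  define p q p' q' where pq: "p = km - k1" "q = kn - k1" "p' = m - km" "q' = n - kn"
  define D where "D = rdiag k1 (sing_val A)"
  define s where "s = sigma_min D"
  define X1 X2 X3 Y1 Y2 Y3 where XY: "X1 = adj U1h * U1" "X2 = adj U2h * U1" "X3 = adj U3h * U1"
    "Y1 = adj V1h * V1" "Y2 = adj V2h * V1" "Y3 = adj V3h * V1"
  note U = Uh_dims[folded pq] and V = Vh_dims[folded pq] and blk = blk_dims[folded pq]
  note dims = A[THEN carrier_matD(1)] A[THEN carrier_matD(2)]
    U[THEN carrier_matD(1)] U[THEN carrier_matD(2)] V[THEN carrier_matD(1)] V[THEN carrier_matD(2)]
    blk[THEN carrier_matD(1)] blk[THEN carrier_matD(2)]
    U1(1)[THEN carrier_matD(1)] U1(1)[THEN carrier_matD(2)] V1(1)[THEN carrier_matD(1)] V1(1)[THEN carrier_matD(2)]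
  have Ddims: "D \<in> carrier_mat k1 k1" "dim_row D = k1" "dim_col D = k1" "adj D = D"
    by (auto simp: D_def rdiag_mat_diag adj_diag)
  have XYdims: "dim_row X1 = k1" "dim_row X2 = p" "dim_row X3 = p'" "dim_row Y1 = k1" "dim_row Y2 = q" "dim_row Y3 = q'"
    "dim_col X1 = k1" "dim_col X2 = k1" "dim_col X3 = k1" "dim_col Y1 = k1" "dim_col Y2 = k1" "dim_col Y3 = k1"
    by (simp_all add: XY dims)
  define Uh Vh where "Uh = append_cols U1h (append_cols U2h U3h)" and "Vh = append_cols V1h (append_cols V2h V3h)"
  note UhD = unitary_matD[OF Uh_unitary, folded Uh_def] and VhD = unitary_matD[OF Vh_unitary, folded Vh_def]

  \<comment> \<open>The diagonal form is given for both blocks jointly. Comparing entries separates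
    them, and the diagonal of \<open>Sig2\<close> continues with index
    \<open>k1 + 1\<close>.\<close>
  have sig_entry: "four_block_mat Sig1 (0\<^sub>m k1 q) (0\<^sub>m p k1) Sig2 $$ (i,j) = rect_diag km kn sh $$ (i,j)" for i j
    using sig_diag by (simp add: pq)
  have Sig1: "Sig1 = rdiag k1 sh"
  proof (rule eq_matI)
    fix i j assume "i < dim_row (rdiag k1 sh)" "j < dim_col (rdiag k1 sh)"
    then show "Sig1 $$ (i,j) = rdiag k1 sh $$ (i,j)"
      using sig_entry[of i j] k1 by (simp add: dims rdiag_def rect_diag_def)
  qed (simp_all add: dims)
  have Sig2: "Sig2 = rect_diag p q (\<lambda>i. sh (k1 + i))"
  proof (rule eq_matI)
    fix i j assume "i < dim_row (rect_diag p q (\<lambda>i. sh (k1 + i)))" "j < dim_col (rect_diag p q (\<lambda>i. sh (k1 + i)))"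
    then show "Sig2 $$ (i,j) = rect_diag p q (\<lambda>i. sh (k1 + i)) $$ (i,j)"
      using sig_entry[of "k1 + i" "k1 + j"] k1 by (simp add: dims rect_diag_def pq)
  qed (simp_all add: dims)

  \<comment> \<open>Taking adjoints exchanges the \<open>U\<close> and \<open>V\<close> bases and
    turns \<open>S\<close> and \<open>R\<close> into each other's place, which is the shape required
    for the adjoint block equations.\<close>
  have decomp': "adj Vh * adj A * Uh
      = four_block_mat (four_block_mat (adj Sig1) (0\<^sub>m k1 p) (0\<^sub>m q k1) (adj Sig2)) (adj S1 @\<^sub>r adj S2)
          (append_cols (adj R1) (adj R2)) (adj A3)"
  proof -
    have "adj Vh * adj A * Uh = adj (adj Uh * A * Vh)"
      using UhD VhD by (simp add: adj_mult mat_assoc dims)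
    also have "\<dots> = four_block_mat (adj (four_block_mat Sig1 (0\<^sub>m k1 q) (0\<^sub>m p k1) Sig2)) (adj (append_cols S1 S2))
          (adj (R1 @\<^sub>r R2)) (adj A3)"
      unfolding Uh_def Vh_def decomp pq[symmetric]
      by (rule adj_four_block[of _ "k1 + p" "k1 + q" _ q' _ p']) (auto simp: dims intro!: carrier_matI)
    also have "adj (four_block_mat Sig1 (0\<^sub>m k1 q) (0\<^sub>m p k1) Sig2) = four_block_mat (adj Sig1) (0\<^sub>m k1 p) (0\<^sub>m q k1) (adj Sig2)"
      using adj_four_block[of Sig1 k1 k1 "0\<^sub>m k1 q" q "0\<^sub>m p k1" p Sig2] blk by simp
    finally show ?thesis by (simp add: append_cols_adj append_rows_adj dims)
  qed
  have triplet2': "adj A * U1 = V1 * D"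
    using arg_cong[OF triplet2[folded D_def], of adj] by (simp add: adj_mult dims Ddims)
  note eq = block_equations[OF A U V Uh_unitary Vh_unitary blk decomp[folded pq] U1(1) V1(1) Ddims(1) triplet1[folded D_def], folded XY]
  have adj_blk: "adj A \<in> carrier_mat n m" "adj Sig1 \<in> carrier_mat k1 k1" "adj Sig2 \<in> carrier_mat q p"
    "adj S1 \<in> carrier_mat k1 p'" "adj S2 \<in> carrier_mat q p'" "adj R1 \<in> carrier_mat q' k1" "adj R2 \<in> carrier_mat q' p"
    "adj A3 \<in> carrier_mat q' p'"
    using A blk by simp_all
  note eq' = block_equations[OF adj_blk(1) V U Vh_unitary Uh_unitary adj_blk(2-) decomp'[unfolded Uh_def Vh_def]
      V1(1) U1(1) Ddims(1) triplet2', folded XY]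
  note isoU = block_isometry[OF N U Uh_unitary U1, folded XY]
  note isoV = block_isometry[OF N V Vh_unitary V1, folded XY]

  have Gap: "sigma_min Sig1 - spec_norm A3 > 0" using Gap_pos by (simp add: Gap_def)
  have sigma1: "sigma_min Sig1 = Min (sh ` {1..k1})" unfolding Sig1 by (rule sigma_min_rdiag) (rule sh_nonneg)
  define s1 where "s1 = sigma_min Sig1"
  have s1: "0 < s1" using Gap spec_norm_nonneg[of A3] by (simp add: s1_def)
  have s1_sh: "s1 \<le> sh j" if "1 \<le> j" "j \<le> k1" for j
    unfolding s1_def sigma1 using that by (intro Min_le) auto
  have compress: "adj U1h * A * V1h = rdiag k1 sh"
  proof (rule eq_matI)
    fix i j assume "i < dim_row (rdiag k1 sh)" "j < dim_col (rdiag k1 sh)"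
    then have ij: "i < k1" "j < k1" by simp_all
    have km: "k1 \<le> m" "k1 \<le> n" using k1 kmkn by auto
    have "(adj Uh * A * Vh) $$ (i,j) = Sig1 $$ (i,j)"
      unfolding Uh_def Vh_def decomp pq[symmetric] using ij by (simp add: dims)
    moreover have "adj Uh * A * Vh = append_cols (adj Uh * A * V1h) (adj Uh * A * append_cols V2h V3h)"
      unfolding Vh_def using UhD by (intro mult_append_cols) (simp_all add: dims)
    moreover have "adj Uh * A * V1h = (adj U1h * A * V1h) @\<^sub>r ((adj U2h @\<^sub>r adj U3h) * A * V1h)"
      unfolding Uh_def by (simp add: append_cols_adj append_rows_mult dims)
    ultimately show "(adj U1h * A * V1h) $$ (i,j) = rdiag k1 sh $$ (i,j)"
      using ij km UhD unfolding Sig1 by (simp add: dims del: index_mult_mat(1))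
  qed (simp_all add: dims)
  \<comment> \<open>The compression is taken with \<open>V1h\<close> as the isometry and
    \<open>adj U1h\<close> as the contraction; it carries \<open>Sig1\<close>, whose diagonal is at
    least \<open>s1\<close>.\<close>
  have sing: "s1 \<le> sing_val A i" if "1 \<le> i" "i \<le> k1" for i
    by (rule sing_val_ge_compression[OF A V(1) isoV(5) _ isoU(4) compress])
      (use U(1) s1 s1_sh that k1 kmkn mn in auto)
  \<comment> \<open>The positive lower bound \<open>s1\<close> supplies the nonnegativity under
    which \<open>sigma_min\<close> of a diagonal matrix is its least entry.\<close>
  have s_eq: "s = Min (sing_val A ` {1..k1})"
    unfolding s_def D_def using sing s1 by (intro sigma_min_rdiag) (meson less_imp_le order_trans)
  have s_ge: "s1 \<le> s"
    unfolding s_eq using k1 sing by (subst Min_ge_iff) auto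
  have s_pos: "0 < s" using s_ge s1 by simp
  have s_le: "s \<le> sing_val A i" if "1 \<le> i" "i \<le> k1" for i
    unfolding s_eq using that by (intro Min_le) auto

  define c where "c = spec_norm A3"
  have Gap_le: "Gap \<le> s - c" using s_ge by (simp add: Gap_def c_def s1_def)
  have gap_eq: "gap = s - spec_norm Sig2" by (simp add: gap_def s_def D_def)
  have adj_op: "op_bound (spec_norm M) M \<or> op_bound (spec_norm M) (adj M)"
      "op_bound (spec_norm M) (adj M) \<or> op_bound (spec_norm M) (adj (adj M))" for M
    using op_bound_spec_norm[of M] by simp_all
  note nn = ui_norm_nonneg[OF N] spec_norm_nonneg

  \<comment> \<open>The coupled pair: by the second block rows for \<open>A\<close> and for its
    adjoint, \<open>X2\<close> and \<open>Y2\<close> bound each other up to a multiple of a third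
    block.\<close>
  have x2: "s * N X2 \<le> spec_norm Sig2 * N Y2 + spec_norm R2 * N Y3"
  proof -
    have "s * N X2 \<le> N (Sig2 * Y2) + N (R2 * Y3)"
      by (rule ui_norm_two_term_bound[OF N eq(1)[unfolded D_def]]) (simp_all add: XYdims dims s_pos s_le)
    also have "N (Sig2 * Y2) \<le> spec_norm Sig2 * N Y2"
      by (rule ui_norm_mult_left[OF N adj_op(1)]) (simp add: XYdims dims)
    also have "N (R2 * Y3) \<le> spec_norm R2 * N Y3"
      by (rule ui_norm_mult_left[OF N adj_op(1)]) (simp add: XYdims dims)
    finally show ?thesis by simp
  qed
  have y2: "s * N Y2 \<le> spec_norm Sig2 * N X2 + spec_norm S2 * N X3"
  proof -
    have "s * N Y2 \<le> N (adj Sig2 * X2) + N (adj S2 * X3)"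
      by (rule ui_norm_two_term_bound[OF N eq'(1)[unfolded D_def]]) (simp_all add: XYdims dims s_pos s_le)
    also have "N (adj Sig2 * X2) \<le> spec_norm Sig2 * N X2"
      by (rule ui_norm_mult_left[OF N adj_op(2)]) (simp add: XYdims dims)
    also have "N (adj S2 * X3) \<le> spec_norm S2 * N X3"
      by (rule ui_norm_mult_left[OF N adj_op(2)]) (simp add: XYdims dims)
    finally show ?thesis by simp
  qed
  \<comment> \<open>The leading term stays unsplit: as \<open>S\<close> times a contraction it gives
    (i), as two separate summands it gives (ii) and (iii).\<close>
  have x3: "s * N X3 \<le> N (S1 * Y1 + S2 * Y2) + c * N Y3"
  proof -
    have "s * N X3 \<le> N (X3 * D)"
      unfolding D_def by (rule ui_norm_mult_rdiag_ge[OF N]) (simp_all add: XYdims s_pos s_le)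
    also have "\<dots> \<le> N (S1 * Y1 + S2 * Y2) + N (A3 * Y3)"
      unfolding eq(2)[symmetric] by (rule ui_norm_triangle[OF N]) (simp_all add: XYdims dims)
    also have "N (A3 * Y3) \<le> c * N Y3"
      unfolding c_def by (rule ui_norm_mult_left[OF N adj_op(1)]) (simp add: XYdims dims)
    finally show ?thesis by simp
  qed
  have y3: "s * N Y3 \<le> N (adj R1 * X1 + adj R2 * X2) + c * N X3"
  proof -
    have "s * N Y3 \<le> N (Y3 * D)"
      unfolding D_def by (rule ui_norm_mult_rdiag_ge[OF N]) (simp_all add: XYdims s_pos s_le)
    also have "\<dots> \<le> N (adj R1 * X1 + adj R2 * X2) + N (adj A3 * X3)"
      unfolding eq'(2)[symmetric] by (rule ui_norm_triangle[OF N]) (simp_all add: XYdims dims)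
    also have "N (adj A3 * X3) \<le> c * N X3"
      unfolding c_def by (rule ui_norm_mult_left[OF N adj_op(2)]) (simp add: XYdims dims)
    finally show ?thesis by simp
  qed
  have S1: "N (S1 * Y1 + S2 * Y2) \<le> N S1 + N (S2 * Y2)"
  proof -
    have "N (S1 * Y1 + S2 * Y2) \<le> N (S1 * Y1) + N (S2 * Y2)"
      by (rule ui_norm_triangle[OF N]) (simp_all add: XYdims dims)
    also have "N (S1 * Y1) \<le> 1 * N S1"
      by (rule ui_norm_mult_right[OF N]) (use isoV(1) in \<open>simp_all add: XYdims dims\<close>)
    finally show ?thesis by simp
  qed
  have R1: "N (adj R1 * X1 + adj R2 * X2) \<le> N R1 + N (adj R2 * X2)"
  proof -
    have "N (adj R1 * X1 + adj R2 * X2) \<le> N (adj R1 * X1) + N (adj R2 * X2)"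
      by (rule ui_norm_triangle[OF N]) (simp_all add: XYdims dims)
    also have "N (adj R1 * X1) \<le> 1 * N (adj R1)"
      by (rule ui_norm_mult_right[OF N]) (use isoU(1) in \<open>simp_all add: XYdims dims\<close>)
    finally show ?thesis by (simp add: ui_norm_adj[OF N])
  qed
  have Theta: "Theta \<le> max (N X2) (N Y2) + max (N X3) (N Y3)"
    unfolding Theta_def using isoU(3) isoV(3) by linarith

  have part1: "Theta \<le> max (N R) (N S) / Gap * (1 + max (spec_norm R2) (spec_norm S2) / gap)"
  proof -
    have "append_cols S1 S2 * (Y1 @\<^sub>r Y2) = S1 * Y1 + S2 * Y2"
      by (rule append_cols_mult_rows) (simp_all add: XYdims dims)
    moreover have "N (append_cols S1 S2 * (Y1 @\<^sub>r Y2)) \<le> 1 * N (append_cols S1 S2)"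
      by (rule ui_norm_mult_right[OF N]) (use isoV(2) in \<open>simp_all add: XYdims dims\<close>)
    ultimately have NS: "N (S1 * Y1 + S2 * Y2) \<le> N S" by (simp add: S_def)
    have "append_cols (adj R1) (adj R2) * (X1 @\<^sub>r X2) = adj R1 * X1 + adj R2 * X2"
      by (rule append_cols_mult_rows) (simp_all add: XYdims dims)
    moreover have "append_cols (adj R1) (adj R2) = adj (R1 @\<^sub>r R2)" by (simp add: append_rows_adj dims)
    moreover have "N (append_cols (adj R1) (adj R2) * (X1 @\<^sub>r X2)) \<le> 1 * N (append_cols (adj R1) (adj R2))"
      by (rule ui_norm_mult_right[OF N]) (use isoU(2) in \<open>simp_all add: XYdims dims\<close>)
    ultimately have NR: "N (adj R1 * X1 + adj R2 * X2) \<le> N R" by (simp add: R_def ui_norm_adj[OF N])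
    define t where "t = max (N X3) (N Y3)"
    have t: "0 \<le> t" "N X3 \<le> t" "N Y3 \<le> t" using nn(1) by (auto simp: t_def le_max_iff_disj)
    have c0: "0 \<le> c" by (simp add: c_def spec_norm_nonneg)
    have "c * N Y3 \<le> c * t" "c * N X3 \<le> c * t" using t c0 by (auto intro: mult_left_mono)
    then have "s * N X3 \<le> max (N R) (N S) + c * t" "s * N Y3 \<le> max (N R) (N S) + c * t"
      using x3 y3 NS NR by linarith+
    then have "s * t \<le> max (N R) (N S) + c * t" unfolding t_def by (rule mult_max_le)
    moreover have "Gap * t \<le> (s - c) * t" using Gap_le t(1) by (rule mult_right_mono)
    ultimately have "t * Gap \<le> max (N R) (N S)" by (simp add: algebra_simps)
    then have t_le: "t \<le> max (N R) (N S) / Gap" using Gap_pos by (metis pos_le_divide_eq)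
    have "max (N X2) (N Y2) \<le> max (spec_norm R2) (spec_norm S2) / (s - spec_norm Sig2) * t"
      unfolding t_def
      by (rule max_le_of_coupled_bounds[OF x2 y2]) (use gap_pos gap_eq nn in auto)
    then have "Theta \<le> t * (1 + max (spec_norm R2) (spec_norm S2) / gap)"
      using Theta unfolding gap_eq t_def[symmetric] distrib_left by (simp only: mult_1_right mult.commute[of t])
    also have "\<dots> \<le> max (N R) (N S) / Gap * (1 + max (spec_norm R2) (spec_norm S2) / gap)"
      using t_le gap_pos nn(2) by (intro mult_right_mono) (auto simp: le_max_iff_disj)
    finally show ?thesis .
  qed

  have part2: "Theta \<le> max (N S1) (N R1) / (Gap - (max (spec_norm S2) (spec_norm R2))\<^sup>2 / gap)
      * (1 + max (spec_norm R2) (spec_norm S2) / gap)"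
    if "Gap > (max (spec_norm S2) (spec_norm R2))\<^sup>2 / gap"
  proof -
    have "N (S2 * Y2) \<le> spec_norm S2 * N Y2"
      by (rule ui_norm_mult_left[OF N adj_op(1)]) (simp add: XYdims dims)
    then have x3': "s * N X3 \<le> N S1 + spec_norm S2 * N Y2 + c * N Y3" using x3 S1 by linarith
    have "N (adj R2 * X2) \<le> spec_norm R2 * N X2"
      by (rule ui_norm_mult_left[OF N adj_op(2)]) (simp add: XYdims dims)
    then have y3': "s * N Y3 \<le> N R1 + spec_norm R2 * N X2 + c * N X3" using y3 R1 by linarith
    have "Theta \<le> max (N S1) (N R1)
        / (Gap - (\<Sum>i\<in>{()}. (max (spec_norm R2) (spec_norm S2))\<^sup>2 / (s - spec_norm Sig2)))
        * (1 + (\<Sum>i\<in>{()}. max (spec_norm R2) (spec_norm S2) / (s - spec_norm Sig2)))"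
      \<comment> \<open>The index set is the one-element type, so each sum collapses to the single
        quotient over \<open>gap\<close>.\<close>
      by (rule angle_bound_of_coupled_bounds[where x = "\<lambda>_. N X2" and y = "\<lambda>_. N Y2" and x' = "N X3" and y' = "N Y3" and c = c])
        (use x2 y2 x3' y3' Theta Gap_le that gap_pos nn in \<open>auto simp: gap_eq max.commute c_def\<close>)
    then show ?thesis by (simp add: gap_eq max.commute)
  qed

  have part3: "Theta \<le> max (N S1) (N R1) / (Gap - (\<Sum>i=1..kp. (max (r2 i) (s2 i))\<^sup>2 / (s - shat (k1 + i))))
      * (1 + (\<Sum>i=1..kp. max (r2 i) (s2 i) / (s - shat (k1 + i))))"
    if less: "Gap > (\<Sum>i=1..kp. (max (r2 i) (s2 i))\<^sup>2 / (s - shat (k1 + i)))"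
  proof -
    define x y where "x i = N (row_mat X2 (i - 1))" and "y i = N (row_mat Y2 (i - 1))" for i
    have r2: "0 \<le> r2 i" and s2: "0 \<le> s2 i" for i by (simp_all add: r2_def s2_def)
    have xy0: "0 \<le> x i" "0 \<le> y i" for i by (simp_all add: x_def y_def nn)
    have kp: "p \<le> kp" "q \<le> kp" by (simp_all add: kp_def pq)
    \<comment> \<open>\<open>min p q\<close> equals \<open>min km kn - k1\<close>, so
      \<open>shat\<close> becomes zero exactly where the diagonal of \<open>Sig2\<close> ends. The
      shift \<open>i - 1\<close> passes to rows counted from zero.\<close>
    have shat_eq: "shat (k1 + i) = (if i - 1 < min p q then sh (k1 + Suc (i - 1)) else 0)" if "1 \<le> i" for i
      using that k1 by (auto simp: shat_def pq)
    have x_pair: "s * x i \<le> shat (k1 + i) * y i + r2 i * N Y3" if i: "1 \<le> i" for i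
    proof -
      have "s * N (row_mat X2 (i - 1)) \<le> (if i - 1 < min p q then sh (k1 + Suc (i - 1)) else 0) * N (row_mat Y2 (i - 1))
        + (if i - 1 < p then vec_norm2 (row R2 (i - 1)) else 0) * N Y3"
        by (rule ui_norm_row_bound[OF N eq(1)[unfolded D_def Sig2]]) (simp_all add: XYdims dims s_pos s_le sh_nonneg)
      moreover have "r2 i = (if i - 1 < p then vec_norm2 (row R2 (i - 1)) else 0)" using i by (auto simp: r2_def pq)
      ultimately show ?thesis by (simp only: shat_eq[OF i] x_def y_def)
    qed
    have y_pair: "s * y i \<le> shat (k1 + i) * x i + s2 i * N X3" if i: "1 \<le> i" for i
    proof -
      have "s * N (row_mat Y2 (i - 1)) \<le> (if i - 1 < min q p then sh (k1 + Suc (i - 1)) else 0) * N (row_mat X2 (i - 1))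
        + (if i - 1 < q then vec_norm2 (row (adj S2) (i - 1)) else 0) * N X3"
        by (rule ui_norm_row_bound[OF N eq'(1)[unfolded D_def Sig2 adj_rect_diag]]) (simp_all add: XYdims dims s_pos s_le sh_nonneg)
      \<comment> \<open>Rows of \<open>adj S2\<close> are conjugated columns of \<open>S2\<close>,
        hence of equal length.\<close>
      moreover have "s2 i = (if i - 1 < q then vec_norm2 (row (adj S2) (i - 1)) else 0)"
        using i by (auto simp: s2_def pq vec_norm2_def dims)
      ultimately show ?thesis by (simp only: shat_eq[OF i] x_def y_def min.commute)
    qed
    \<comment> \<open>On the diagonal of \<open>Sig2\<close> an entry is at most its spectral norm,
      which \<open>gap > 0\<close> keeps below \<open>s\<close>; past the diagonal
      \<open>shat\<close> is zero. Thus every denominator in the sums is positive.\<close>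
    have shat_less: "shat (k1 + i) < s" if i: "1 \<le> i" for i
    proof (cases "i - 1 < min p q")
      case True
      then have "cmod (Sig2 $$ (i - 1, i - 1)) \<le> spec_norm Sig2"
        by (intro cmod_index_le_spec_norm) (simp_all add: dims)
      then have "sh (k1 + Suc (i - 1)) \<le> spec_norm Sig2"
        using True sh_nonneg[of "k1 + Suc (i - 1)"] by (simp add: Sig2 rect_diag_def)
      then show ?thesis using True gap_pos by (simp only: shat_eq[OF i] gap_eq if_True)
    next
      case False
      then have "shat (k1 + i) = 0" using shat_eq[OF i] by (simp only: if_False)
      then show ?thesis using s_pos by simp
    qed
    have shat_nonneg: "0 \<le> shat j" for j by (simp add: shat_def sh_nonneg)
    have "N (S2 * Y2) \<le> (\<Sum>i<q. vec_norm2 (col S2 i) * N (row_mat Y2 i))"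
      using ui_norm_mult_rows[OF N, of S2 Y2] by (simp add: XYdims dims)
    \<comment> \<open>Matrix columns and rows count from zero, \<open>s2\<close> and
      \<open>y\<close> from one; the terms added between \<open>q\<close> and \<open>kp\<close> are
      nonnegative.\<close>
    also have "\<dots> \<le> (\<Sum>i=1..kp. s2 i * y i)"
      by (rule sum_lessThan_le_shift[OF kp(2)]) (use s2 xy0 in \<open>auto simp: s2_def y_def pq\<close>)
    finally have x3': "s * N X3 \<le> N S1 + (\<Sum>i=1..kp. s2 i * y i) + c * N Y3" using x3 S1 by linarith
    have "N (adj R2 * X2) \<le> (\<Sum>i<p. vec_norm2 (col (adj R2) i) * N (row_mat X2 i))"
      using ui_norm_mult_rows[OF N, of "adj R2" X2] by (simp add: XYdims dims)
    also have "\<dots> \<le> (\<Sum>i=1..kp. r2 i * x i)"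
    proof (rule sum_lessThan_le_shift[OF kp(1)])
      fix i assume "i < p"
      then have "vec_norm2 (col (adj R2) i) = r2 (Suc i)" by (simp add: r2_def pq vec_norm2_def dims)
      then show "vec_norm2 (col (adj R2) i) * N (row_mat X2 i) \<le> r2 (Suc i) * x (Suc i)" by (simp add: x_def)
    qed (simp add: r2 xy0)
    finally have y3': "s * N Y3 \<le> N R1 + (\<Sum>i=1..kp. r2 i * x i) + c * N X3" using y3 R1 by linarith
    have "N X2 \<le> (\<Sum>i<p. N (row_mat X2 i))" using ui_norm_le_sum_rows[OF N, of X2] by (simp add: XYdims)
    also have "\<dots> \<le> (\<Sum>i=1..kp. max (x i) (y i))"
      by (rule sum_lessThan_le_shift[OF kp(1)]) (use xy0 in \<open>auto simp: x_def le_max_iff_disj\<close>)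
    finally have X2: "N X2 \<le> (\<Sum>i=1..kp. max (x i) (y i))" .
    have "N Y2 \<le> (\<Sum>i<q. N (row_mat Y2 i))" using ui_norm_le_sum_rows[OF N, of Y2] by (simp add: XYdims)
    also have "\<dots> \<le> (\<Sum>i=1..kp. max (x i) (y i))"
      by (rule sum_lessThan_le_shift[OF kp(2)]) (use xy0 in \<open>auto simp: y_def le_max_iff_disj\<close>)
    finally have Theta': "Theta \<le> (\<Sum>i=1..kp. max (x i) (y i)) + max (N X3) (N Y3)" using Theta X2 by linarith
    show ?thesis
    proof (rule angle_bound_of_coupled_bounds[where c = c])
      show "s * N X3 \<le> N S1 + (\<Sum>i=1..kp. s2 i * y i) + c * N Y3" by (rule x3')
      show "s * N Y3 \<le> N R1 + (\<Sum>i=1..kp. r2 i * x i) + c * N X3" by (rule y3')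
      show "Theta \<le> (\<Sum>i=1..kp. max (x i) (y i)) + max (N X3) (N Y3)" by (rule Theta')
    qed (use x_pair y_pair shat_less shat_nonneg r2 s2 nn Gap_le less in \<open>auto simp: c_def\<close>)
  qed
  show ?thesis using part1 part2 part3 unfolding s_def D_def by blast
qed

end
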